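(* Let $c>0$, $\delta\in(0,1)$, $0<\gamma<1$, and let $m,n,l,K\ge1$ be integers. Let $s_1,\dots,s_m$ be states sampled i.i.d. according to the probability distribution $d$, and for each state $s_i$ let $n$ independent rollouts truncated at length $l$ be sampled, with $\bar v(s_i)$ the average of the $n$ truncated returns and $\bar\sigma_i$ their (empirical) standard deviation. Let $\hat v$ range over $K$ value functions $\mathcal S\to\mathbb R$. Then with probability at least $1-\delta$, for all these $\hat v$, $$\left|\ell(\hat v,v^* )-\hat\ell(\hat v,\bar v)\right|\le\sqrt{\frac{\log(4K/\delta)\,c^2}{2m}}+\zeta,$$ where $$\zeta=3R_{\max}\left(\frac{1-\gamma^{l}}{1-\gamma}\right)\frac{\log(6m/\delta)}{n}+\frac{\sum_{i=1}^m\bar\sigma_i}{m}\sqrt{\frac{2\log(6m/\delta)}{n}}+R_{\max}\frac{\gamma^{l}}{1-\gamma}.$$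
   Context: Setting: a Markov decision process with state space $\mathcal S$, rewards bounded in absolute value by $R_{\max}$, constant discount $\gamma$, and a fixed policy $\pi$. $v^*(s)=\mathbb E\left[\sum_{k=0}^\infty\gamma^kR_k\right]$ is the expected discounted return from $s$ under $\pi$. A rollout from $s_i$ truncated at length $l$ gives the truncated return $g_{ij}=\sum_{k=0}^{l-1}\gamma^kr_{ijk}$, $j=1,\dots,n$; $\bar v(s_i)=\frac1n\sum_{j=1}^n g_{ij}$ and $\bar\sigma_i=\sqrt{\frac1n\sum_{j=1}^n(g_{ij}-\bar v(s_i))^2}$. Loss (clipped mean absolute value error): $\ell(\hat v,v)=\mathbb E_{S\sim d}\left[\min(c,|\hat v(S)-v(S)|)\right]$ and $\hat\ell(\hat v,v)=\frac1m\sum_{i=1}^m\min(c,|\hat v(s_i)-v(s_i)|)$. *)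

theory Defs
  imports "HOL-Probability.Probability"
begin

text \<open>
  A Markov decision process is given by a measurable state space \<open>S\<close>, a measurable action space
  \<open>A\<close> and a kernel \<open>T\<close> from state-action pairs to joint laws of (reward, next state), i.e.
  \<open>T \<in> S \<Otimes>\<^sub>M A \<rightarrow>\<^sub>M prob_algebra (borel \<Otimes>\<^sub>M S)\<close>. A policy is a kernel
  \<open>\<pi> \<in> S \<rightarrow>\<^sub>M prob_algebra A\<close>. The \<open>k\<close>-th entry of a trajectory is the
  triple \<open>(A\<^sub>k, R\<^sub>k, S\<^sub>k\<^sub>+\<^sub>1)\<close>; the initial state is kept separately.
\<close>

definition step_space :: "'s measure \<Rightarrow> 'a measure \<Rightarrow> ('a \<times> real \<times> 's) measure" where
  "step_space S A = A \<Otimes>\<^sub>M (borel \<Otimes>\<^sub>M S)"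

definition step_law ::
  "'s measure \<Rightarrow> 'a measure \<Rightarrow> ('s \<times> 'a \<Rightarrow> (real \<times> 's) measure) \<Rightarrow> ('s \<Rightarrow> 'a measure) \<Rightarrow>
    's \<Rightarrow> ('a \<times> real \<times> 's) measure" where
  "step_law S A T \<pi> s =
     \<pi> s \<bind> (\<lambda>a. distr (T (s, a)) (step_space S A) (\<lambda>x. (a, x)))"

definition state_at :: "'s \<Rightarrow> (nat \<Rightarrow> 'a \<times> real \<times> 's) \<Rightarrow> nat \<Rightarrow> 's" where
  "state_at s \<omega> k = (case k of 0 \<Rightarrow> s | Suc j \<Rightarrow> snd (snd (\<omega> j)))"

definition reward_at :: "(nat \<Rightarrow> 'a \<times> real \<times> 's) \<Rightarrow> nat \<Rightarrow> real" where
  "reward_at \<omega> k = fst (snd (\<omega> k))"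

text \<open>
  The law of the infinite trajectory started in \<open>s\<close>: the Ionescu-Tulcea extension of the
  one-step laws, so that conditionally on the first \<open>k\<close> entries the next one has law
  \<open>step_law S A T \<pi> (state_at s \<omega> k)\<close>.
\<close>

definition trajectory_law ::
  "'s measure \<Rightarrow> 'a measure \<Rightarrow> ('s \<times> 'a \<Rightarrow> (real \<times> 's) measure) \<Rightarrow> ('s \<Rightarrow> 'a measure) \<Rightarrow>
    's \<Rightarrow> (nat \<Rightarrow> 'a \<times> real \<times> 's) measure" where
  "trajectory_law S A T \<pi> s =
     projective_family.lim UNIV
       (Ionescu_Tulcea.CI (\<lambda>k \<omega>. step_law S A T \<pi> (state_at s \<omega> k)) (\<lambda>_. step_space S A))
       (\<lambda>_. step_space S A)"

definition policy_value ::
  "'s measure \<Rightarrow> 'a measure \<Rightarrow> ('s \<times> 'a \<Rightarrow> (real \<times> 's) measure) \<Rightarrow> ('s \<Rightarrow> 'a measure) \<Rightarrow>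
    real \<Rightarrow> 's \<Rightarrow> real" where
  "policy_value S A T \<pi> \<gamma> s = (\<integral>\<omega>. (\<Sum>k. \<gamma> ^ k * reward_at \<omega> k) \<partial>trajectory_law S A T \<pi> s)"

definition rollout_law ::
  "'s measure \<Rightarrow> 'a measure \<Rightarrow> ('s \<times> 'a \<Rightarrow> (real \<times> 's) measure) \<Rightarrow> ('s \<Rightarrow> 'a measure) \<Rightarrow>
    nat \<Rightarrow> 's \<Rightarrow> (nat \<Rightarrow> 'a \<times> real \<times> 's) measure" where
  "rollout_law S A T \<pi> l s =
     distr (trajectory_law S A T \<pi> s) (PiM {..<l} (\<lambda>_. step_space S A)) (\<lambda>\<omega>. restrict \<omega> {..<l})"

definition truncated_return :: "real \<Rightarrow> nat \<Rightarrow> (nat \<Rightarrow> 'a \<times> real \<times> 's) \<Rightarrow> real" where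
  "truncated_return \<gamma> l \<omega> = (\<Sum>k<l. \<gamma> ^ k * reward_at \<omega> k)"

text \<open>
  One data point is a state \<open>s \<sim> d\<close> together with \<open>n\<close> rollouts that are i.i.d. conditionally
  on \<open>s\<close>; the data set consists of \<open>m\<close> i.i.d. data points.
\<close>

definition data_point_space ::
  "'s measure \<Rightarrow> 'a measure \<Rightarrow> nat \<Rightarrow> nat \<Rightarrow> ('s \<times> (nat \<Rightarrow> nat \<Rightarrow> 'a \<times> real \<times> 's)) measure" where
  "data_point_space S A l n =
     S \<Otimes>\<^sub>M PiM {..<n} (\<lambda>_. PiM {..<l} (\<lambda>_. step_space S A))"

definition data_point_law ::
  "'s measure \<Rightarrow> 'a measure \<Rightarrow> ('s \<times> 'a \<Rightarrow> (real \<times> 's) measure) \<Rightarrow> ('s \<Rightarrow> 'a measure) \<Rightarrow>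
    's measure \<Rightarrow> nat \<Rightarrow> nat \<Rightarrow> ('s \<times> (nat \<Rightarrow> nat \<Rightarrow> 'a \<times> real \<times> 's)) measure" where
  "data_point_law S A T \<pi> d l n =
     d \<bind> (\<lambda>s. distr (PiM {..<n} (\<lambda>_. rollout_law S A T \<pi> l s))
                    (data_point_space S A l n) (\<lambda>\<rho>. (s, \<rho>)))"

definition sample_law ::
  "'s measure \<Rightarrow> 'a measure \<Rightarrow> ('s \<times> 'a \<Rightarrow> (real \<times> 's) measure) \<Rightarrow> ('s \<Rightarrow> 'a measure) \<Rightarrow>
    's measure \<Rightarrow> nat \<Rightarrow> nat \<Rightarrow> nat \<Rightarrow> (nat \<Rightarrow> 's \<times> (nat \<Rightarrow> nat \<Rightarrow> 'a \<times> real \<times> 's)) measure" where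
  "sample_law S A T \<pi> d l n m = PiM {..<m} (\<lambda>_. data_point_law S A T \<pi> d l n)"

definition sampled_state :: "(nat \<Rightarrow> 's \<times> (nat \<Rightarrow> nat \<Rightarrow> 'a \<times> real \<times> 's)) \<Rightarrow> nat \<Rightarrow> 's" where
  "sampled_state D i = fst (D i)"

definition sampled_return ::
  "real \<Rightarrow> nat \<Rightarrow> (nat \<Rightarrow> 's \<times> (nat \<Rightarrow> nat \<Rightarrow> 'a \<times> real \<times> 's)) \<Rightarrow> nat \<Rightarrow> nat \<Rightarrow> real" where
  "sampled_return \<gamma> l D i j = truncated_return \<gamma> l (snd (D i) j)"

definition value_estimate ::
  "real \<Rightarrow> nat \<Rightarrow> nat \<Rightarrow> (nat \<Rightarrow> 's \<times> (nat \<Rightarrow> nat \<Rightarrow> 'a \<times> real \<times> 's)) \<Rightarrow> nat \<Rightarrow> real" where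
  "value_estimate \<gamma> l n D i = (\<Sum>j<n. sampled_return \<gamma> l D i j) / real n"

definition return_std ::
  "real \<Rightarrow> nat \<Rightarrow> nat \<Rightarrow> (nat \<Rightarrow> 's \<times> (nat \<Rightarrow> nat \<Rightarrow> 'a \<times> real \<times> 's)) \<Rightarrow> nat \<Rightarrow> real" where
  "return_std \<gamma> l n D i =
     sqrt ((\<Sum>j<n. (sampled_return \<gamma> l D i j - value_estimate \<gamma> l n D i)\<^sup>2) / real n)"

definition clipped_loss :: "'s measure \<Rightarrow> real \<Rightarrow> ('s \<Rightarrow> real) \<Rightarrow> ('s \<Rightarrow> real) \<Rightarrow> real" where
  "clipped_loss d c vh v = (\<integral>s. min c \<bar>vh s - v s\<bar> \<partial>d)"

text \<open>
  The second value argument of the empirical loss is indexed by the sample number rather than by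
  the state: a state that is drawn twice has two, in general different, Monte Carlo estimates.
\<close>

definition empirical_clipped_loss ::
  "nat \<Rightarrow> (nat \<Rightarrow> 's) \<Rightarrow> real \<Rightarrow> ('s \<Rightarrow> real) \<Rightarrow> (nat \<Rightarrow> real) \<Rightarrow> real" where
  "empirical_clipped_loss m s c vh u = (\<Sum>i<m. min c \<bar>vh (s i) - u i\<bar>) / real m"


text \<open>
  The constructions above are well-formed: all laws are probability measures and depend
  measurably on the starting state.
\<close>

context
  fixes S :: "'s measure" and A :: "'a measure"
    and T :: "'s \<times> 'a \<Rightarrow> (real \<times> 's) measure" and \<pi> :: "'s \<Rightarrow> 'a measure"
  assumes T: "T \<in> S \<Otimes>\<^sub>M A \<rightarrow>\<^sub>M prob_algebra (borel \<Otimes>\<^sub>M S)"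
    and \<pi>: "\<pi> \<in> S \<rightarrow>\<^sub>M prob_algebra A"
begin

lemma step_law_measurable: "step_law S A T \<pi> \<in> S \<rightarrow>\<^sub>M prob_algebra (step_space S A)"
proof -
  note [measurable] = T \<pi>
  show ?thesis
    unfolding step_law_def[abs_def] step_space_def by measurable
qed

lemma state_at_measurable:
  "(\<lambda>(s, \<omega>). state_at s \<omega> k) \<in> S \<Otimes>\<^sub>M PiM {0..<k} (\<lambda>_. step_space S A) \<rightarrow>\<^sub>M S"
  unfolding state_at_def step_space_def by (cases k) (auto simp: case_prod_beta)

lemma trajectory_kernel_measurable:
  "(\<lambda>(s, \<omega>). step_law S A T \<pi> (state_at s \<omega> k))
     \<in> S \<Otimes>\<^sub>M PiM {0..<k} (\<lambda>_. step_space S A) \<rightarrow>\<^sub>M prob_algebra (step_space S A)"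
  using measurable_compose[OF state_at_measurable step_law_measurable]
  by (simp add: case_prod_beta)

lemma Ionescu_Tulcea_trajectory:
  assumes s: "s \<in> space S"
  shows "Ionescu_Tulcea (\<lambda>k \<omega>. step_law S A T \<pi> (state_at s \<omega> k)) (\<lambda>_. step_space S A)"
proof -
  have *: "(\<lambda>\<omega>. step_law S A T \<pi> (state_at s \<omega> k))
      \<in> PiM {0..<k} (\<lambda>_. step_space S A) \<rightarrow>\<^sub>M prob_algebra (step_space S A)" for k
    using measurable_compose[OF measurable_Pair1'[OF s] trajectory_kernel_measurable] by simp
  show ?thesis
  proof (rule Ionescu_Tulcea.intro)
    show "(\<lambda>\<omega>. step_law S A T \<pi> (state_at s \<omega> k))
      \<in> PiM {0..<k} (\<lambda>_. step_space S A) \<rightarrow>\<^sub>M subprob_algebra (step_space S A)" for k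
      using * by (rule measurable_prob_algebraD)
  next
    fix k and x :: "nat \<Rightarrow> 'a \<times> real \<times> 's"
    assume "x \<in> space (PiM {0..<k} (\<lambda>_. step_space S A))"
    from measurable_space[OF * this] show "prob_space (step_law S A T \<pi> (state_at s x k))"
      by (simp add: space_prob_algebra)
  qed
qed

lemma trajectory_law_measurable:
  "trajectory_law S A T \<pi> \<in> S \<rightarrow>\<^sub>M prob_algebra (PiM UNIV (\<lambda>_. step_space S A))"
proof -
  let ?P = "\<lambda>s k \<omega>. step_law S A T \<pi> (state_at s \<omega> k)" and ?M = "\<lambda>_::nat. step_space S A"
  have C: "(\<lambda>s. Ionescu_Tulcea.C (?P s) ?M 0 k (\<lambda>_. undefined))
      \<in> S \<rightarrow>\<^sub>M prob_algebra (PiM {0..<k} ?M)" for k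
  proof (induction k)
    case 0
    have "(\<lambda>s. return (PiM {0..<0} ?M) (\<lambda>_. undefined)) \<in> S \<rightarrow>\<^sub>M prob_algebra (PiM {0..<0} ?M)"
      by (intro measurable_const) (auto simp: space_prob_algebra space_PiM intro!: prob_space_return)
    then show ?case
      by (rule measurable_cong[THEN iffD1, rotated])
         (simp add: Ionescu_Tulcea.C.simps[OF Ionescu_Tulcea_trajectory])
  next
    case (Suc k)
    have "(\<lambda>(s, \<omega>). distr (?P s k \<omega>) (PiM {0..<Suc k} ?M) (fun_upd \<omega> k))
        \<in> S \<Otimes>\<^sub>M PiM {0..<k} ?M \<rightarrow>\<^sub>M prob_algebra (PiM {0..<Suc k} ?M)"
      unfolding case_prod_beta
    proof (rule measurable_distr_prob_space2)
      show "(\<lambda>p. ?P (fst p) k (snd p)) \<in> S \<Otimes>\<^sub>M PiM {0..<k} ?M \<rightarrow>\<^sub>M prob_algebra (step_space S A)"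
        using trajectory_kernel_measurable by (simp add: case_prod_beta)
      show "(\<lambda>(p, y). (snd p)(k := y))
          \<in> (S \<Otimes>\<^sub>M PiM {0..<k} ?M) \<Otimes>\<^sub>M step_space S A \<rightarrow>\<^sub>M PiM {0..<Suc k} ?M"
        unfolding case_prod_beta by (rule measurable_fun_upd[where J="{0..<k}"]) auto
    qed
    note bind = measurable_bind_prob_space2[OF Suc.IH this]
    have eP: "Ionescu_Tulcea.eP (?P s) ?M k =
        (\<lambda>\<omega>. distr (?P s k \<omega>) (PiM {0..<Suc k} ?M) (fun_upd \<omega> k))" if "s \<in> space S" for s
      by (rule ext) (rule Ionescu_Tulcea.eP_def[OF Ionescu_Tulcea_trajectory[OF that]])
    from bind
    show ?case
      by (rule measurable_cong[THEN iffD1, rotated])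
         (simp add: Ionescu_Tulcea.C.simps[OF Ionescu_Tulcea_trajectory] eP)
  qed
  have pf: "projective_family UNIV (Ionescu_Tulcea.CI (?P s) ?M) ?M" if "s \<in> space S" for s
  proof -
    interpret Ionescu_Tulcea "?P s" ?M using that by (rule Ionescu_Tulcea_trajectory)
    show ?thesis by unfold_locales
  qed
  show ?thesis
  proof (rule measurable_prob_algebra_generated[OF sets_PiM Int_stable_prod_algebra
        prod_algebra_sets_into_space])
    fix s assume s: "s \<in> space S"
    interpret IT: Ionescu_Tulcea "?P s" ?M using s by (rule Ionescu_Tulcea_trajectory)
    show "sets (trajectory_law S A T \<pi> s) = sets (PiM UNIV ?M)"
      by (simp add: trajectory_law_def)
    show "prob_space (trajectory_law S A T \<pi> s)"
    proof
      interpret CI: prob_space "IT.CI {}" by (rule IT.PF.prob_space_P) auto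
      have "emeasure IT.PF.lim (IT.PF.emb UNIV {} (space (PiM {} ?M))) = 1"
        using CI.emeasure_space_1 by (subst IT.lim) (auto simp: IT.PF.space_P)
      then show "emeasure (trajectory_law S A T \<pi> s) (space (trajectory_law S A T \<pi> s)) = 1"
        by (simp add: trajectory_law_def space_PiM prod_emb_def restrict_def vimage_def)
    qed
  next
    fix X assume "X \<in> prod_algebra UNIV ?M"
    then obtain J E where X: "X = prod_emb UNIV ?M J (PiE J E)" and J: "finite J"
      and E: "\<And>i. i \<in> J \<Longrightarrow> E i \<in> sets (step_space S A)"
      by (rule prod_algebraE) auto
    obtain k where k: "J \<subseteq> {0..<k}"
      using J unfolding finite_nat_iff_bounded atLeast0LessThan by (rule exE)
    have PE: "PiE J E \<in> sets (PiM J ?M)"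
      using J E by (intro sets_PiM_I_finite) auto
    have "(\<lambda>s. emeasure (Ionescu_Tulcea.C (?P s) ?M 0 k (\<lambda>_. undefined))
        (prod_emb {0..<k} ?M J (PiE J E))) \<in> borel_measurable S"
      using k PE
      by (intro measurable_compose[OF measurable_prob_algebraD[OF C]
            measurable_emeasure_subprob_algebra] measurable_prod_emb) auto
    then show "(\<lambda>s. emeasure (trajectory_law S A T \<pi> s) X) \<in> borel_measurable S"
    proof (rule measurable_cong[THEN iffD1, rotated])
      fix s assume s: "s \<in> space S"
      interpret IT: Ionescu_Tulcea "?P s" ?M using s by (rule Ionescu_Tulcea_trajectory)
      show "emeasure (IT.C 0 k (\<lambda>_. undefined)) (prod_emb {0..<k} ?M J (PiE J E)) =
          emeasure (trajectory_law S A T \<pi> s) X"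
        using IT.lim[OF J PE] IT.emeasure_CI[OF k PE] by (simp add: trajectory_law_def X)
    qed
  qed
qed

lemma rollout_law_measurable:
  "rollout_law S A T \<pi> l \<in> S \<rightarrow>\<^sub>M prob_algebra (PiM {..<l} (\<lambda>_. step_space S A))"
  unfolding rollout_law_def[abs_def]
  by (rule measurable_compose[OF trajectory_law_measurable measurable_distr_prob_space])
     (rule measurable_restrict_subset, simp)

lemma rollouts_law_measurable:
  "(\<lambda>s. PiM {..<n::nat} (\<lambda>_. rollout_law S A T \<pi> l s))
     \<in> S \<rightarrow>\<^sub>M prob_algebra (PiM {..<n} (\<lambda>_. PiM {..<l} (\<lambda>_. step_space S A)))"
  (is "?K \<in> _ \<rightarrow>\<^sub>M prob_algebra (PiM _ (\<lambda>_. ?R))")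
proof (rule measurable_prob_algebra_generated[OF sets_PiM Int_stable_prod_algebra
      prod_algebra_sets_into_space])
  have R: "prob_space (rollout_law S A T \<pi> l s)" "sets (rollout_law S A T \<pi> l s) = sets ?R"
    if "s \<in> space S" for s
    using measurable_space[OF rollout_law_measurable that, of l] by (auto simp: space_prob_algebra)
  show "prob_space (?K s)" if "s \<in> space S" for s
    using R[OF that] by (intro prob_space_PiM) auto
  show "sets (?K s) = sets (PiM {..<n} (\<lambda>_. ?R))" if "s \<in> space S" for s
    using R[OF that] by (intro sets_PiM_cong) auto
  fix X assume "X \<in> prod_algebra {..<n} (\<lambda>_. ?R)"
  then obtain E where X: "X = PiE {..<n} E" and E: "\<And>i. i < n \<Longrightarrow> E i \<in> sets ?R"
    by (subst (asm) prod_algebra_eq_finite) auto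
  have "(\<lambda>s. \<Prod>i<n. emeasure (rollout_law S A T \<pi> l s) (E i)) \<in> borel_measurable S"
    using E by (intro borel_measurable_prod_ennreal
      measurable_compose[OF measurable_prob_algebraD[OF rollout_law_measurable]
        measurable_emeasure_subprob_algebra]) auto
  then show "(\<lambda>s. emeasure (?K s) X) \<in> borel_measurable S"
  proof (rule measurable_cong[THEN iffD1, rotated])
    fix s assume s: "s \<in> space S"
    interpret rollout: prob_space "rollout_law S A T \<pi> l s" using R[OF s] by simp
    interpret product_sigma_finite "\<lambda>_::nat. rollout_law S A T \<pi> l s" by standard
    show "(\<Prod>i<n. emeasure (rollout_law S A T \<pi> l s) (E i)) = emeasure (?K s) X"
      unfolding X using E R[OF s] by (subst emeasure_PiM) auto
  qed
qed

lemma data_point_law_in_prob_algebra: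
  assumes d: "d \<in> space (prob_algebra S)"
  shows "data_point_law S A T \<pi> d l n \<in> space (prob_algebra (data_point_space S A l n))"
proof -
  have "(\<lambda>s. distr (PiM {..<n} (\<lambda>_. rollout_law S A T \<pi> l s))
      (data_point_space S A l n) (\<lambda>\<rho>. (s, \<rho>))) \<in> S \<rightarrow>\<^sub>M prob_algebra (data_point_space S A l n)"
    unfolding data_point_space_def
    by (rule measurable_distr_prob_space2[OF rollouts_law_measurable]) simp
  from prob_space_bind'[OF d this] sets_bind'[OF d this]
  show ?thesis
    by (simp add: data_point_law_def space_prob_algebra)
qed

lemma prob_space_sample_law:
  assumes "d \<in> space (prob_algebra S)"
  shows "prob_space (sample_law S A T \<pi> d l n m)"
  unfolding sample_law_def
  using data_point_law_in_prob_algebra[OF assms, of l n]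
  by (intro prob_space_PiM) (simp add: space_prob_algebra)

lemma sets_sample_law:
  assumes "d \<in> space (prob_algebra S)"
  shows "sets (sample_law S A T \<pi> d l n m) = sets (PiM {..<m} (\<lambda>_. data_point_space S A l n))"
  unfolding sample_law_def
  using data_point_law_in_prob_algebra[OF assms, of l n]
  by (intro sets_PiM_cong) (simp_all add: space_prob_algebra)

end

end

theory Submission
  imports Defs
begin

text \<open>
  The clipped losses against the exact values concentrate by Hoeffding's inequality, which costs
  \<open>\<delta> / 2\<close> over the \<open>K\<close> functions. Clipping is 1-Lipschitz, so replacing the exact values by the
  estimates costs the average estimation error, which is the truncation bias plus a Monte Carlo
  error controlled by an empirical Bernstein inequality at level \<open>\<delta> / (2 * m) = 3 * exp (- x)\<close>.

  The returns range over an interval of length \<open>2 * B\<close> while the linear term is only \<open>3 * B * x / n\<close>,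
  half of what the usual empirical Bernstein inequality gives. Bounding the deviation in terms of
  the true variance and then the variance in terms of the empirical one is too lossy for this
  constant. Instead, for centred \<open>\<xi>\<close>, the inequality \<open>exp (y - y^2 / 6) \<le> 1 + y + y^2 / 3\<close> yields a
  self-normalised Chernoff bound mixing the empirical and the true variance, with a tilt tuned to
  the true variance; it fails with probability \<open>exp (- x)\<close> on each side. It settles the matter unless the
  empirical second moment is far below or far above the true one, and these two events together
  have probability at most \<open>exp (- x)\<close>.
\<close>

section \<open>Polynomial inequalities behind the exponential tilt\<close>

text \<open>The second derivative \<open>6 * E - 2 * c\<close> of the cubic is nonnegative on
  \<open>[u, v]\<close>, so the cubic is convex there and stays below every affine function that
  dominates it at both ends.\<close>

lemma cubic_below_chord:
  fixes u v E c p k :: real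
  assumes "u \<le> E" "E \<le> v" "c \<le> u" "0 \<le> u"
    and "(u - c) * u\<^sup>2 \<le> p * u + k" "(v - c) * v\<^sup>2 \<le> p * v + k"
  shows "(E - c) * E\<^sup>2 \<le> p * E + k"
proof (cases "u = v")
  case False
  then have uv: "v - u > 0" using assms by auto
  \<comment> \<open>The chord through the values at \<open>u\<close> and \<open>v\<close> exceeds
    the cubic at \<open>E\<close> by \<open>(E - u) * (v - E) * (E + u + v - c)\<close>; the factor
    \<open>v - u\<close> clears the denominator of the chord.\<close>
  have "0 \<le> (E - u) * (v - E) * (E + u + v - c) * (v - u)"
    using assms by (intro mult_nonneg_nonneg) auto
  moreover have "0 \<le> (v - E) * (p * u + k - (u - c) * u\<^sup>2)" "0 \<le> (E - u) * (p * v + k - (v - c) * v\<^sup>2)"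
    using assms by auto
  moreover have "(v - u) * (p * E + k - (E - c) * E\<^sup>2) =
     (v - E) * (p * u + k - (u - c) * u\<^sup>2) + (E - u) * (p * v + k - (v - c) * v\<^sup>2)
     + (E - u) * (v - E) * (E + u + v - c) * (v - u)"
    by (simp add: algebra_simps power2_eq_square)
  ultimately have "0 \<le> (v - u) * (p * E + k - (E - c) * E\<^sup>2)" by linarith
  with uv show ?thesis by (simp add: zero_le_mult_iff)
next
  case True
  then show ?thesis using assms by auto
qed

text \<open>
  Here \<open>53/50\<close> is a lower bound for \<open>c = 3 / (2 sqrt 2)\<close>. The piecewise offsets \<open>e\<close> are chosen so that
  \<open>\<rho> + e\<close> lies between two curves in \<open>\<rho>\<close> that are close to each other near \<open>\<rho> = 3/5\<close>; this is where
  the constants of the argument are tight.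
\<close>
lemma quartic_bounds:
  fixes \<rho> e :: real
  assumes "\<rho> \<in> {17/50..1/2} \<and> e = 143/200 \<or> \<rho> \<in> {1/2..7/10} \<and> e = 137/200 \<or> \<rho> \<ge> 7/10 \<and> e = 131/200"
  shows "2 * (\<rho> + e - 53/50) * (\<rho> + e)\<^sup>2 \<le> 53/50 * (\<rho>\<^sup>2 + 71/50 * \<rho> + 5041/5000) * \<rho>\<^sup>2"
proof -
  have "0 \<le> 53/50 * (\<rho>\<^sup>2 + 71/50 * \<rho> + 5041/5000) * \<rho>\<^sup>2 - 2 * (\<rho> + e - 53/50) * (\<rho> + e)\<^sup>2"
    (is "0 \<le> ?d")
    using assms
  proof (elim disjE conjE)
    assume "\<rho> \<in> {17/50..1/2}" and e: "e = 143/200"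
    \<comment> \<open>Expanded at the left end of the range, the cubic and quartic terms are
      nonnegative, and the constant term pays for the negative ones.\<close>
    then obtain t where t: "\<rho> = 17/50 + t" "0 \<le> t" "t \<le> 4/25"
      by (intro that[of "\<rho> - 17/50"]) auto
    have "?d = 519991469/2500000000 - 9869839/12500000 * t - 217697/250000 * t\<^sup>2 + 2367/2500 * t^3 + 53/50 * t^4"
      unfolding e t(1) by (simp add: power2_eq_square power3_eq_cube power4_eq_xxxx field_simps)
    moreover have "t\<^sup>2 \<le> 4/25 * t" using mult_right_mono[of t "4/25" t] t by (simp add: power2_eq_square)
    moreover have "0 \<le> t^3" "0 \<le> t^4" using t by auto
    ultimately show ?thesis using t by linarith
  next
    assume "\<rho> \<in> {1/2..7/10}" and e: "e = 137/200"
    then obtain t where t: "\<rho> = 1/2 + t" "0 \<le> t" "t \<le> 1/5"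
      by (intro that[of "\<rho> - 1/2"]) auto
    have "?d = 682067/4000000 - 336679/500000 * t - 18377/250000 * t\<^sup>2 + 4063/2500 * t^3 + 53/50 * t^4"
      unfolding e t(1) by (simp add: power2_eq_square power3_eq_cube power4_eq_xxxx field_simps)
    moreover have "t\<^sup>2 \<le> 1/5 * t" using mult_right_mono[of t "1/5" t] t by (simp add: power2_eq_square)
    moreover have "0 \<le> t^3" "0 \<le> t^4" using t by auto
    ultimately show ?thesis using t by linarith
  next
    assume "\<rho> \<ge> 7/10" and e: "e = 131/200"
    then obtain t where t: "\<rho> = 7/10 + t" "0 \<le> t"
      by (intro that[of "\<rho> - 7/10"]) auto
    have "?d = 21119393/100000000 - 269543/2500000 * t + 334003/250000 * t\<^sup>2 + 6183/2500 * t^3 + 53/50 * t^4"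
      unfolding e t(1) by (simp add: power2_eq_square power3_eq_cube power4_eq_xxxx field_simps)
    \<comment> \<open>This range is unbounded, so the positive quadratic term has to help the
      constant absorb the linear one.\<close>
    moreover have "0 \<le> (t - 1/10)\<^sup>2" by simp
    then have "1/5 * t \<le> t\<^sup>2 + 1/100" by (simp add: power2_eq_square algebra_simps)
    moreover have "0 \<le> t^3" "0 \<le> t^4" using t by auto
    ultimately show ?thesis using t by linarith
  qed
  then show ?thesis by (simp only: diff_ge_0_iff_ge)
qed

text \<open>
  On the event that the empirical Bernstein bound fails, \<open>E\<close>, \<open>r\<close>, \<open>q\<close> and \<open>A\<close> below are the deviation,
  the empirical standard deviation, the mean square and the variance, rescaled by the appropriate
  powers of \<open>L = x / n\<close>, and \<open>c = 3 / (2 sqrt 2)\<close>. The conclusion says that the exponential tilt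
  \<open>sqrt 2 / \<tau>\<close> detects the failure. For fixed \<open>E\<close> the only available upper bound on \<open>q\<close> is convex in
  \<open>L\<close>, so it suffices to consider the extreme values of \<open>L\<close>; the resulting bounds on \<open>q\<close> are convex
  in \<open>E\<close> and are compared with the affine function \<open>6 * \<tau> * E\<close> at the endpoints of the range of \<open>E\<close>.
\<close>
lemma tilt_succeeds:
  fixes A L \<rho> \<tau> c E r q :: real
  assumes c: "0 \<le> c" "c\<^sup>2 = 9/8" and L: "0 < L" and A: "0 \<le> A" and \<rho>: "0 \<le> \<rho>"
    and A\<rho>: "A \<le> \<rho>\<^sup>2 + 71/50 * \<rho> + 5041/5000" "\<rho> = 0 \<or> A = \<rho>\<^sup>2 + 71/50 * \<rho> + 5041/5000"
    and \<tau>: "\<tau> = \<rho> + 7/10"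
    and r: "0 \<le> r" "c * (1 + L * A) + r \<le> E"
    and q: "q = r\<^sup>2 + 2 * L * E\<^sup>2" "\<rho>\<^sup>2 \<le> q" "q \<le> 16 * \<tau>\<^sup>2"
    and LE: "L * E \<le> 2 * c / 3"
  shows "q + 2 * A + 3 * \<tau>\<^sup>2 \<le> 6 * \<tau> * E"
proof -
  \<comment> \<open>Rational enclosure of \<open>3 / (2 * sqrt 2)\<close>, which is about
    1.0607.\<close>
  have c1: "53/50 \<le> c" "c \<le> 1061/1000"
    using c power2_le_imp_le[of "53/50" c] power2_le_imp_le[of c "1061/1000"] by (auto simp: power2_eq_square)
  have \<omega>: "0 \<le> c * (L * A)" using c L A by simp
  have Ec: "c \<le> E" using r \<omega> by (simp add: algebra_simps)
  then have E0: "0 < E" using c1 by simp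
  have \<tau>0: "7/10 \<le> \<tau>" and \<rho>\<tau>: "\<rho> = \<tau> - 7/10" using \<tau> \<rho> by auto
  have \<tau>2: "7/10 * \<tau> \<le> \<tau>\<^sup>2" using mult_right_mono[of "7/10" \<tau> \<tau>] \<tau>0 by (simp add: power2_eq_square)
  have A\<tau>: "A \<le> \<tau>\<^sup>2 + 1/50 * \<tau> + 2521/5000"
  proof -
    have "\<rho>\<^sup>2 + 71/50 * \<rho> + 5041/5000 = \<tau>\<^sup>2 + 1/50 * \<tau> + 2521/5000"
      unfolding \<rho>\<tau> by (simp add: power2_eq_square field_simps)
    with A\<rho>(1) show ?thesis by simp
  qed
  have rE: "r \<le> E - c - c * (L * A)" using r by (simp add: algebra_simps)
  have q1: "q \<le> (E - c - c * (L * A))\<^sup>2 + 2 * L * E\<^sup>2"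
    unfolding q(1) using power_mono[OF rE r(1), of 2] by simp
  \<comment> \<open>The variance penalty \<open>c * (L * A)\<close> is dropped, and \<open>L\<close>
    is replaced by the largest value that \<open>L * E \<le> 2 * c / 3\<close> allows.\<close>
  have q2: "q \<le> (E - c)\<^sup>2 + (4 * c / 3) * E"
  proof -
    have "(E - c - c * (L * A))\<^sup>2 \<le> (E - c)\<^sup>2"
      by (rule power_mono) (use \<omega> rE r in auto)
    moreover have "2 * L * E\<^sup>2 \<le> (4 * c / 3) * E"
      using mult_right_mono[OF LE, of "2 * E"] E0 by (simp add: power2_eq_square mult_ac)
    ultimately show ?thesis using q1 by linarith
  qed
  have cE: "53/50 * E \<le> c * E" "c * E \<le> 1061/1000 * E" using c1 E0 by auto
  have c\<tau>: "53/50 * \<tau> \<le> c * \<tau>" "c * \<tau> \<le> 1061/1000 * \<tau>" using c1 \<tau>0 by auto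
  have expand: "(E - c)\<^sup>2 = E\<^sup>2 - 2 * (c * E) + 9/8" using c(2) by (simp add: power2_eq_square algebra_simps)
  \<comment> \<open>From \<open>4 * \<tau>\<close> on, the crude bound
    \<open>16 * \<tau>\<^sup>2\<close> on \<open>q\<close> suffices; on the middle range
    \<open>q2\<close> does. Below \<open>2 * \<tau>\<close>, a small \<open>A\<close> forces
    \<open>\<rho> = 0\<close> and \<open>q2\<close> is still enough, while for larger
    \<open>A\<close> the variance penalty is indispensable.\<close>
  consider "4 * \<tau> \<le> E" | "2 * \<tau> \<le> E" "E \<le> 4 * \<tau>" | "E < 2 * \<tau>" "A \<le> 7/10" | "E < 2 * \<tau>" "7/10 \<le> A"
    by linarith
  then show ?thesis
  proof cases
    case 1
    have "24 * \<tau>\<^sup>2 \<le> 6 * \<tau> * E" using mult_left_mono[OF 1, of "6 * \<tau>"] \<tau>0 by (simp add: power2_eq_square)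
    then show ?thesis using q(3) A\<tau> \<tau>2 \<tau>0 by linarith
  next
    case 2
    \<comment> \<open>The chord of the square over \<open>[2 * \<tau>, 4 * \<tau>]\<close> turns the
      quadratic bound \<open>q2\<close> into an affine one.\<close>
    have "E\<^sup>2 \<le> (6 * \<tau>) * E - 8 * \<tau>\<^sup>2"
      using mult_nonneg_nonneg[of "E - 2 * \<tau>" "4 * \<tau> - E"] 2 by (simp add: power2_eq_square algebra_simps)
    then show ?thesis using q2 cE 2 A\<tau> \<tau>2 \<tau>0 expand by linarith
  next
    case 3
    have "0 \<le> \<rho>\<^sup>2" by simp
    with 3 have "\<rho> = 0" using A\<rho>(2) \<rho> by linarith
    then have \<tau>': "\<tau> = 7/10" using \<tau> by simp
    have "E\<^sup>2 \<le> c * E + 7/5 * E - 7/5 * c"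
      using mult_nonneg_nonneg[of "E - c" "7/5 - E"] 3 Ec \<tau>' by (simp add: power2_eq_square field_simps)
    then show ?thesis using q2 expand cE c1 3 Ec unfolding \<tau>' power2_eq_square[of "7/10"] by linarith
  next
    case 4
    have A0: "0 < A" using 4 by simp
    \<comment> \<open>The value of the bound \<open>q1\<close> at the largest admissible
      \<open>L\<close>, the one with \<open>c * (L * A) = E - c\<close>.\<close>
    define G where "G = 2 * (E - c) * E\<^sup>2 / (c * A)"
    have G0: "0 \<le> G" unfolding G_def using Ec c1 A0 by simp
    \<comment> \<open>As a function of \<open>y = c * (L * A)\<close> in \<open>[0, E - c]\<close>
      the bound \<open>q1\<close> is convex, hence at most the larger of its end values
      \<open>(E - c)\<^sup>2\<close> and \<open>G\<close>.\<close>
    have q3: "q \<le> (E - c)\<^sup>2 \<or> q \<le> G"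
    proof (rule ccontr)
      assume "\<not> ?thesis"
      then have n: "(E - c)\<^sup>2 < q" "G < q" by auto
      let ?z = "E - c" let ?y = "c * (L * A)"
      have y: "0 \<le> ?y" "?y \<le> ?z" using \<omega> rE r by auto
      show False
      proof (cases "?z = 0")
        case True
        then have "?y = 0" using y by simp
        then have "L = 0" using c1 A0 by auto
        with L show False by simp
      next
        case False
        then have z: "?z > 0" using Ec by simp
        have "?z * q \<le> ?z * ((?z - ?y)\<^sup>2 + 2 * L * E\<^sup>2)" using q1 z by (intro mult_left_mono) auto
        also have "\<dots> \<le> (?z - ?y) * ?z\<^sup>2 + ?y * G"
        proof -
          have "?y * G = 2 * L * E\<^sup>2 * ?z" unfolding G_def using c1 A0 by (simp add: field_simps)
          moreover have "?z * (?z - ?y)\<^sup>2 \<le> ?z * ((?z - ?y) * ?z)"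
            using y z by (intro mult_left_mono) (auto simp: power2_eq_square intro!: mult_left_mono)
          ultimately show ?thesis by (simp add: algebra_simps power2_eq_square)
        qed
        finally have "?z * q \<le> (?z - ?y) * ?z\<^sup>2 + ?y * G" .
        moreover have "?y > 0" using c1 A0 L by simp
        then have "?y * G < ?y * q" using n(2) by (rule mult_strict_left_mono[rotated])
        moreover have "(?z - ?y) * ?z\<^sup>2 \<le> (?z - ?y) * q" using y n by (intro mult_left_mono) auto
        moreover have "(?z - ?y) * q + ?y * q = ?z * q" by (simp add: algebra_simps)
        ultimately show False by linarith
      qed
    qed
    have \<tau>sq: "\<tau>\<^sup>2 = \<rho>\<^sup>2 + 7/5 * \<rho> + 49/100"
      unfolding \<tau> by (simp add: power2_eq_square field_simps)
    \<comment> \<open>The desired inequality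
      \<open>G \<le> 6 * \<tau> * E - 2 * A - 3 * \<tau>\<^sup>2\<close> at the right end
      \<open>E = 2 * \<tau>\<close>, cleared of denominators.\<close>
    have A9: "8 * \<tau>\<^sup>2 * (2 * \<tau> - c) \<le> c * A * (9 * \<tau>\<^sup>2 - 2 * A)"
    proof -
      have "8 * \<tau>\<^sup>2 * (2 * \<tau> - c) \<le> 8 * \<tau>\<^sup>2 * (2 * \<tau> - 53/50)"
        using c1 by (intro mult_left_mono) auto
      moreover have "53/50 * A * (9 * \<tau>\<^sup>2 - 2 * A) \<le> c * A * (9 * \<tau>\<^sup>2 - 2 * A)"
        using c1 A0 A\<tau> \<tau>2 \<tau>0 by (intro mult_right_mono) auto
      moreover have "8 * \<tau>\<^sup>2 * (2 * \<tau> - 53/50) \<le> 53/50 * A * (9 * \<tau>\<^sup>2 - 2 * A)"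
        using A\<rho>(2)
      proof
        assume \<rho>0: "\<rho> = 0"
        have "0 \<le> (A - 7/10) * (5041/5000 - A)" using 4 A\<rho>(1) \<rho>0 by (intro mult_nonneg_nonneg) auto
        then show ?thesis using 4 \<rho>0 unfolding \<tau> by (simp add: power2_eq_square field_simps)
      next
        assume A': "A = \<rho>\<^sup>2 + 71/50 * \<rho> + 5041/5000"
        have eq: "53/50 * A * (9 * \<tau>\<^sup>2 - 2 * A) - 8 * \<tau>\<^sup>2 * (2 * \<tau> - 53/50) =
            23930101/19531250 + 3727001/1562500 * \<rho> - 102797/250000 * \<rho>\<^sup>2 + 2441/500 * \<rho>^3 + 371/50 * \<rho>^4"
          unfolding A' \<tau> by (simp add: power2_eq_square power3_eq_cube power4_eq_xxxx field_simps)
        \<comment> \<open>The only negative coefficient is that of \<open>\<rho>\<^sup>2\<close>;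
          the linear and cubic terms absorb it.\<close>
        have "0 \<le> \<rho> * (\<rho> - 1)\<^sup>2" using \<rho> by simp
        then have "2 * \<rho>\<^sup>2 \<le> \<rho> + \<rho>^3" by (simp add: power2_eq_square power3_eq_cube algebra_simps)
        moreover have "0 \<le> \<rho>^3" "0 \<le> \<rho>^4" using \<rho> by auto
        ultimately have "0 \<le> 53/50 * A * (9 * \<tau>\<^sup>2 - 2 * A) - 8 * \<tau>\<^sup>2 * (2 * \<tau> - 53/50)"
          unfolding eq using \<rho> by linarith
        then show ?thesis by (simp only: diff_ge_0_iff_ge)
      qed
      ultimately show ?thesis by linarith
    qed
    from q3 show ?thesis
    proof
      assume q4: "q \<le> (E - c)\<^sup>2"
      \<comment> \<open>Since \<open>\<rho>\<^sup>2 \<le> q\<close>, the range of \<open>E\<close>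
        now starts at \<open>c + \<rho>\<close>, and the chord of the square over
        \<open>[c + \<rho>, 4 * \<tau>]\<close> gives an affine bound.\<close>
      have \<rho>E: "\<rho> \<le> E - c" by (rule power2_le_imp_le) (use q4 q Ec in auto)
      have "E\<^sup>2 \<le> (c + \<rho> + 4 * \<tau>) * E - 4 * \<tau> * (c + \<rho>)"
        using mult_nonneg_nonneg[of "E - c - \<rho>" "4 * \<tau> - E"] 4 \<rho>E \<tau>0
        by (simp add: power2_eq_square algebra_simps)
      then have "E\<^sup>2 \<le> c * E + 5 * \<tau> * E - 7/10 * E - 4 * (c * \<tau>) - 4 * \<tau>\<^sup>2 + 14/5 * \<tau>"
        unfolding \<rho>\<tau> by (simp add: power2_eq_square algebra_simps)
      moreover have "(\<tau> + 9/25) * \<tau> \<le> E * \<tau>"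
        using \<rho>E c1 \<tau>0 unfolding \<rho>\<tau> by (intro mult_right_mono) auto
      then have "\<tau>\<^sup>2 + 9/25 * \<tau> \<le> \<tau> * E" by (simp add: power2_eq_square algebra_simps)
      ultimately show ?thesis using q4 A\<tau> \<tau>2 \<tau>0 \<rho>E cE c\<tau> c1 expand unfolding \<rho>\<tau> by linarith
    next
      assume q4: "q \<le> G"
      \<comment> \<open>\<open>u\<close> is a left end for the range of \<open>E\<close>. The second
        condition says that \<open>G\<close> is at most \<open>\<rho>\<^sup>2\<close> at
        \<open>u\<close>; as \<open>G\<close> increases and is at least
        \<open>q \<ge> \<rho>\<^sup>2\<close> at \<open>E\<close>, this gives
        \<open>u \<le> E\<close>. With the third condition it also gives the affine comparison at
        \<open>u\<close>. For small \<open>\<rho>\<close> the choice \<open>u = c\<close>, where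
        \<open>G\<close> vanishes, is good enough.\<close>
      obtain u where u: "c \<le> u" "2 * (u - c) * u\<^sup>2 \<le> c * A * \<rho>\<^sup>2" "\<rho>\<^sup>2 + 2 * A + 3 * \<tau>\<^sup>2 \<le> 6 * \<tau> * u"
      proof (cases "\<rho> < 17/50")
        case True
        have "\<rho>\<^sup>2 \<le> 17/50 * \<rho>" using mult_right_mono[of \<rho> "17/50" \<rho>] \<rho> True by (simp add: power2_eq_square)
        then have "\<rho>\<^sup>2 + 2 * A + 3 * \<tau>\<^sup>2 \<le> 159/25 * \<tau>"
          using A\<rho>(1) \<rho> True unfolding \<tau>sq unfolding \<tau> by (simp add: field_simps)
        also have "\<dots> \<le> 6 * \<tau> * c" using c\<tau> by (simp add: mult.commute[of c])
        finally have "\<rho>\<^sup>2 + 2 * A + 3 * \<tau>\<^sup>2 \<le> 6 * \<tau> * c" .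
        then show ?thesis using that[of c] c1 A0 by simp
      next
        case False
        then have A': "A = \<rho>\<^sup>2 + 71/50 * \<rho> + 5041/5000" using A\<rho>(2) by auto
        note witness = that
        \<comment> \<open>The witness is \<open>\<rho> + e\<close>, unless it lies below
          \<open>c\<close>; then \<open>c\<close> is larger and satisfies the third condition all
          the more.\<close>
        have *: thesis if e: "\<rho> \<in> {17/50..1/2} \<and> e = 143/200 \<or> \<rho> \<in> {1/2..7/10} \<and> e = 137/200 \<or> \<rho> \<ge> 7/10 \<and> e = 131/200"
          for e :: real
        proof (cases "c \<le> \<rho> + e")
          case True
          have le: "\<rho>\<^sup>2 + 2 * A + 3 * \<tau>\<^sup>2 \<le> 6 * \<tau> * (\<rho> + e)"
            using e unfolding A' \<tau>sq unfolding \<tau> by (elim disjE conjE; hypsubst; simp add: power2_eq_square field_simps)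
          have "2 * (\<rho> + e - c) * (\<rho> + e)\<^sup>2 \<le> 2 * (\<rho> + e - 53/50) * (\<rho> + e)\<^sup>2"
            using c1 by (intro mult_right_mono) auto
          also have "\<dots> \<le> 53/50 * A * \<rho>\<^sup>2" unfolding A' by (rule quartic_bounds[OF e])
          also have "\<dots> \<le> c * A * \<rho>\<^sup>2" using c1 A0 by (intro mult_right_mono) auto
          finally show ?thesis using witness[of "\<rho> + e"] True le by simp
        next
          case c: False
          have "\<rho>\<^sup>2 + 2 * A + 3 * \<tau>\<^sup>2 \<le> 6 * \<tau> * (\<rho> + e)"
            using e unfolding A' \<tau>sq unfolding \<tau> by (elim disjE conjE; hypsubst; simp add: power2_eq_square field_simps)
          also have "\<dots> \<le> 6 * \<tau> * c" using c \<tau>0 by (intro mult_left_mono) auto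
          finally show ?thesis using witness[of c] c1 A0 by simp
        qed
        show ?thesis
          using *[of "143/200"] *[of "137/200"] *[of "131/200"] False
          by (cases "\<rho> \<le> 1/2"; cases "\<rho> \<le> 7/10") auto
      qed
      have cA: "0 < c * A" using c1 A0 by simp
      have uE: "u \<le> E"
      proof (rule ccontr)
        assume "\<not> u \<le> E"
        then have "(E - c) * E\<^sup>2 < (u - c) * u\<^sup>2"
          using Ec E0 c1 by (intro mult_strict_mono) (auto intro: power_strict_mono)
        then have "2 * (E - c) * E\<^sup>2 < c * A * \<rho>\<^sup>2" using u(2) by linarith
        then have "G < \<rho>\<^sup>2" unfolding G_def using cA by (simp add: field_simps)
        then show False using q4 q(2) by simp
      qed
      have "c * A * (\<rho>\<^sup>2 + 2 * A + 3 * \<tau>\<^sup>2) \<le> c * A * (6 * \<tau> * u)"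
        using u(3) cA by (intro mult_left_mono) auto
      then have "(u - c) * u\<^sup>2 \<le> (3 * \<tau> * (c * A)) * u + (- (2 * A + 3 * \<tau>\<^sup>2) * (c * A) / 2)"
        using u(2) by (simp add: field_simps)
      moreover have "(2 * \<tau> - c) * (2 * \<tau>)\<^sup>2 \<le> (3 * \<tau> * (c * A)) * (2 * \<tau>) + (- (2 * A + 3 * \<tau>\<^sup>2) * (c * A) / 2)"
        using A9 by (simp add: power2_eq_square field_simps)
      ultimately have "(E - c) * E\<^sup>2 \<le> (3 * \<tau> * (c * A)) * E + (- (2 * A + 3 * \<tau>\<^sup>2) * (c * A) / 2)"
        using uE 4 u(1) c1 by (intro cubic_below_chord[of u E "2 * \<tau>"]) auto
      then have "2 * (E - c) * E\<^sup>2 \<le> (6 * \<tau> * E - 2 * A - 3 * \<tau>\<^sup>2) * (c * A)"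
        by (simp add: field_simps)
      then have "G \<le> 6 * \<tau> * E - 2 * A - 3 * \<tau>\<^sup>2"
        unfolding G_def using cA by (simp only: pos_divide_le_eq)
      with q4 show ?thesis by simp
    qed
  qed
qed

section \<open>Exponential moments and the Chernoff bound\<close>

text \<open>The logarithm \<open>g\<close> of the quotient of the two sides has a derivative with
  the sign of \<open>y\<close>, so its minimum is \<open>g 0 = 0\<close>. The coefficients 1/6 and
  1/3 make both sides agree to third order at 0, and the bound holds on the whole line.\<close>

lemma exp_le_quadratic:
  fixes y :: real
  shows "exp (y - y\<^sup>2 / 6) \<le> 1 + y + y\<^sup>2 / 3"
proof -
  define p where "p = (\<lambda>y::real. 1 + y + y\<^sup>2 / 3)"
  define g where "g = (\<lambda>y. ln (p y) - y + y\<^sup>2 / 6)"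
  have p: "0 < p y" for y
  proof -
    have "p y = (y / 2 + 1)\<^sup>2 + y\<^sup>2 / 12"
      unfolding p_def by (simp add: power2_eq_square field_simps)
    then show ?thesis
      by (cases "y = 0") (auto intro!: add_nonneg_pos)
  qed
  have g': "(g has_real_derivative y ^ 3 / (9 * p y)) (at y)" for y
  proof -
    have "(g has_real_derivative (1 + 2 * y / 3) / p y - 1 + y / 3) (at y)"
      unfolding g_def using p[of y] by (auto simp: p_def intro!: derivative_eq_intros)
    moreover have "(1 + 2 * y / 3) / p y - 1 + y / 3 = y ^ 3 / (9 * p y)"
    proof -
      have "(1 + 2 * y / 3) - (1 - y / 3) * p y = y ^ 3 / 9"
        unfolding p_def by (simp add: power2_eq_square power3_eq_cube field_simps)
      moreover have "(1 + 2 * y / 3) / p y - 1 + y / 3 = ((1 + 2 * y / 3) - (1 - y / 3) * p y) / p y"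
        using p[of y] by (simp add: field_simps)
      ultimately show ?thesis by (simp only: divide_divide_eq_left)
    qed
    ultimately show ?thesis by simp
  qed
  have "0 \<le> g y"
  proof (cases "0 \<le> y")
    case True
    have "g 0 \<le> g y"
    proof (rule DERIV_nonneg_imp_nondecreasing[OF True])
      show "\<exists>D. (g has_real_derivative D) (at z) \<and> 0 \<le> D" if "0 \<le> z" for z
        using p[of z] that by (intro exI[of _ "z ^ 3 / (9 * p z)"] conjI g') auto
    qed
    then show ?thesis by (simp add: g_def p_def)
  next
    case False
    then have "y \<le> 0" by simp
    then have "g 0 \<le> g y"
    proof (rule DERIV_nonpos_imp_nonincreasing)
      show "\<exists>D. (g has_real_derivative D) (at z) \<and> D \<le> 0" if "z \<le> 0" for z
        using p[of z] that
          by (intro exI[of _ "z ^ 3 / (9 * p z)"] conjI g' divide_nonpos_pos) (auto simp: power_le_zero_eq)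
    qed
    then show ?thesis by (simp add: g_def p_def)
  qed
  then have "y - y\<^sup>2 / 6 \<le> ln (p y)" by (simp add: g_def)
  then have "exp (y - y\<^sup>2 / 6) \<le> p y" using p[of y] by (metis exp_le_cancel_iff exp_ln)
  then show ?thesis by (simp add: p_def)
qed

text \<open>Markov's inequality for the exponential of the sum, whose expectation factorises over
  the independent coordinates. Stating the moment as a nonnegative integral avoids any integrability
  condition on \<open>exp (h x)\<close>.\<close>

lemma chernoff_PiM:
  fixes h :: "'a \<Rightarrow> real" and t \<kappa> :: real
  assumes M: "prob_space M" and h[measurable]: "h \<in> borel_measurable M" and I: "finite I"
    and mgf: "(\<integral>\<^sup>+x. exp (h x) \<partial>M) \<le> exp \<kappa>"
  shows "measure (PiM I (\<lambda>_. M)) {\<omega> \<in> space (PiM I (\<lambda>_. M)). t \<le> (\<Sum>i\<in>I. h (\<omega> i))}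
    \<le> exp (card I * \<kappa> - t)"
proof -
  interpret M: prob_space M by fact
  interpret P: product_prob_space "\<lambda>_. M" I by standard
  let ?P = "PiM I (\<lambda>_. M)"
  let ?X = "{\<omega> \<in> space ?P. t \<le> (\<Sum>i\<in>I. h (\<omega> i))}"
  have "emeasure ?P ?X = (\<integral>\<^sup>+\<omega>. indicator ?X \<omega> \<partial>?P)"
    using I by (subst nn_integral_indicator) auto
  also have "\<dots> \<le> (\<integral>\<^sup>+\<omega>. ennreal (exp (- t)) * (\<Prod>i\<in>I. ennreal (exp (h (\<omega> i)))) \<partial>?P)"
  proof (rule nn_integral_mono)
    fix \<omega>
    show "indicator ?X \<omega> \<le> ennreal (exp (- t)) * (\<Prod>i\<in>I. ennreal (exp (h (\<omega> i))))"
      using I by (auto simp: indicator_def prod_ennreal exp_sum[symmetric] ennreal_mult[symmetric]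
          exp_add[symmetric] intro!: one_le_exp_iff[THEN iffD2])
  qed
  also have "\<dots> = ennreal (exp (- t)) * (\<Prod>i\<in>I. \<integral>\<^sup>+x. exp (h x) \<partial>M)"
    using I by (subst nn_integral_cmult, measurable) (subst P.product_nn_integral_prod, auto)
  also have "\<dots> \<le> ennreal (exp (- t)) * (\<Prod>i\<in>I. ennreal (exp \<kappa>))"
    by (intro mult_left_mono prod_mono_ennreal mgf) auto
  also have "\<dots> = ennreal (exp (card I * \<kappa> - t))"
    by (simp add: ennreal_power exp_of_nat_mult[symmetric] ennreal_mult[symmetric] exp_add[symmetric] algebra_simps)
  finally show ?thesis
    by (simp add: P.emeasure_eq_measure)
qed

text \<open>The linear term integrates to zero because \<open>\<xi>\<close> is centred, and
  \<open>1 + z \<le> exp z\<close> moves the quadratic term into the exponent. This serves the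
  tilted sums and, with \<open>a = 0\<close>, the sums of squares.\<close>

lemma mgf_le_of_quadratic:
  fixes h \<xi> :: "'a \<Rightarrow> real"
  assumes M: "prob_space M" and \<xi>[measurable]: "\<xi> \<in> borel_measurable M"
    and bd: "AE x in M. \<bar>\<xi> x\<bar> \<le> 1" and mean: "(\<integral>x. \<xi> x \<partial>M) = 0"
    and le: "AE x in M. exp (h x) \<le> 1 + a * \<xi> x + b * (\<xi> x)\<^sup>2"
  shows "(\<integral>\<^sup>+x. exp (h x) \<partial>M) \<le> exp (b * (\<integral>x. (\<xi> x)\<^sup>2 \<partial>M))"
proof -
  interpret prob_space M by fact
  have i1: "integrable M \<xi>"
    by (rule integrable_const_bound[of _ 1]) (use bd in auto)
  have i2: "integrable M (\<lambda>x. (\<xi> x)\<^sup>2)"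
    by (rule integrable_const_bound[of _ 1]) (use bd in \<open>auto simp: abs_square_le_1\<close>)
  have "(\<integral>\<^sup>+x. exp (h x) \<partial>M) \<le> (\<integral>\<^sup>+x. ennreal (1 + a * \<xi> x + b * (\<xi> x)\<^sup>2) \<partial>M)"
    using le by (intro nn_integral_mono_AE) (auto simp: ennreal_leI)
  also have "\<dots> = ennreal (\<integral>x. 1 + a * \<xi> x + b * (\<xi> x)\<^sup>2 \<partial>M)"
  proof (rule nn_integral_eq_integral)
    show "integrable M (\<lambda>x. 1 + a * \<xi> x + b * (\<xi> x)\<^sup>2)" using i1 i2 by simp
    show "AE x in M. 0 \<le> 1 + a * \<xi> x + b * (\<xi> x)\<^sup>2"
      using le by eventually_elim (meson exp_ge_zero order_trans)
  qed
  also have "(\<integral>x. 1 + a * \<xi> x + b * (\<xi> x)\<^sup>2 \<partial>M) = 1 + b * (\<integral>x. (\<xi> x)\<^sup>2 \<partial>M)"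
    using i1 i2 mean by (simp add: prob_space)
  also have "ennreal \<dots> \<le> ennreal (exp (b * (\<integral>x. (\<xi> x)\<^sup>2 \<partial>M)))"
    by (intro ennreal_leI) simp
  finally show ?thesis .
qed

section \<open>Empirical Bernstein inequality\<close>

text \<open>\<open>\<Delta>\<close> is the deviation, \<open>S\<close> the empirical variance and
  \<open>q\<close> the empirical second moment about the true mean. In the rescaled quantities this
  is \<open>tilt_succeeds\<close>; multiplying by \<open>L / (3 * \<tau>\<^sup>2)\<close> brings its
  conclusion into the form of a Chernoff exponent with tilt \<open>sqrt 2 / \<tau>\<close>.\<close>

lemma failure_implies_tilt:
  fixes L v \<rho> \<tau> \<Delta> S q :: real
  assumes L: "0 < L" and v: "0 \<le> v" and \<rho>: "0 \<le> \<rho>"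
    and v\<rho>: "v / L \<le> \<rho>\<^sup>2 + 71/50 * \<rho> + 5041/5000" "\<rho> = 0 \<or> v / L = \<rho>\<^sup>2 + 71/50 * \<rho> + 5041/5000"
    and \<tau>: "\<tau> = \<rho> + 7/10"
    and S: "0 \<le> S" and q: "q = S + \<Delta>\<^sup>2" "\<rho>\<^sup>2 * L \<le> q" "q \<le> 16 * \<tau>\<^sup>2 * L"
    and \<Delta>: "\<Delta> \<le> 1" "sqrt S * sqrt (2 * L) + 3/2 * (1 + v) * L \<le> \<Delta>"
  shows "L \<le> sqrt 2 / \<tau> * \<Delta> - (sqrt 2 / \<tau>)\<^sup>2 / 6 * q - (sqrt 2 / \<tau>)\<^sup>2 / 3 * v"
proof -
  define c E r where "c = 3 / (2 * sqrt 2)" and "E = \<Delta> / (sqrt 2 * L)" and "r = sqrt S / sqrt L"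
  have \<tau>0: "0 < \<tau>" using \<tau> \<rho> by simp
  have "q / L + 2 * (v / L) + 3 * \<tau>\<^sup>2 \<le> 6 * \<tau> * E"
  proof (rule tilt_succeeds[OF _ _ L _ \<rho> v\<rho> \<tau>])
    show "0 \<le> c" "c\<^sup>2 = 9/8" by (simp_all add: c_def power_divide power_mult_distrib)
    show "0 \<le> v / L" using v L by simp
    show "0 \<le> r" using S L by (simp add: r_def)
    show "c * (1 + L * (v / L)) + r \<le> E"
    proof -
      have "(c * (1 + v) + r) * (sqrt 2 * L) = sqrt S * sqrt (2 * L) + 3/2 * (1 + v) * L"
      proof -
        have "r * (sqrt 2 * L) = sqrt S * sqrt (2 * L)"
        proof -
          have "r * (sqrt 2 * (sqrt L * sqrt L)) = sqrt S * (sqrt 2 * sqrt L)"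
            unfolding r_def using L by (simp only: times_divide_eq_left) (simp add: field_simps)
          then show ?thesis using L by (simp add: real_sqrt_mult)
        qed
        moreover have "c * (1 + v) * (sqrt 2 * L) = 3/2 * (1 + v) * L"
          by (simp add: c_def)
        ultimately show ?thesis by (simp add: algebra_simps)
      qed
      then show ?thesis using \<Delta>(2) L by (simp add: E_def pos_le_divide_eq)
    qed
    show "q / L = r\<^sup>2 + 2 * L * E\<^sup>2"
      using S L by (simp add: q(1) r_def E_def power_divide power_mult_distrib power2_eq_square field_simps)
    show "\<rho>\<^sup>2 \<le> q / L" using q(2) L by (simp add: pos_le_divide_eq)
    show "q / L \<le> 16 * \<tau>\<^sup>2" using q(3) L by (simp add: pos_divide_le_eq)
    have "L * E = \<Delta> / sqrt 2" using L by (simp add: E_def)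
    also have "\<dots> \<le> 1 / sqrt 2" using \<Delta>(1) by (simp add: divide_right_mono)
    finally show "L * E \<le> 2 * c / 3" by (simp add: c_def)
  qed
  then have "L * (q / L + 2 * (v / L) + 3 * \<tau>\<^sup>2) / (3 * \<tau>\<^sup>2) \<le> L * (6 * \<tau> * E) / (3 * \<tau>\<^sup>2)"
    using L by (intro divide_right_mono mult_left_mono) auto
  moreover have "L * (q / L + 2 * (v / L) + 3 * \<tau>\<^sup>2) / (3 * \<tau>\<^sup>2) = L + (sqrt 2 / \<tau>)\<^sup>2 / 6 * q + (sqrt 2 / \<tau>)\<^sup>2 / 3 * v"
    using L \<tau>0 by (simp add: power_divide field_simps)
  moreover have "L * (6 * \<tau> * E) / (3 * \<tau>\<^sup>2) = sqrt 2 / \<tau> * \<Delta>"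
  proof -
    have "2 * L * E = (sqrt 2 * sqrt 2) * L * E" by simp
    also have "\<dots> = sqrt 2 * (sqrt 2 * L * E)" by (simp only: mult.assoc)
    also have "sqrt 2 * L * E = \<Delta>" using L by (simp add: E_def)
    finally have "2 * L * E = sqrt 2 * \<Delta>" .
    then show ?thesis using \<tau>0 by (simp add: power2_eq_square field_simps)
  qed
  ultimately show ?thesis by linarith
qed

text \<open>Convexity of \<open>exp\<close>. Applied to squares of variables bounded by 1, it
  controls their exponential moments through the mean square alone.\<close>

lemma exp_le_chord:
  fixes \<beta> y :: real
  assumes "0 \<le> y" "y \<le> 1"
  shows "exp (\<beta> * y) \<le> 1 + (exp \<beta> - 1) * y"
proof -
  have "exp ((1 - y) *\<^sub>R 0 + y *\<^sub>R \<beta>) \<le> (1 - y) * exp 0 + y * exp \<beta>"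
    using assms by (intro convex_onD[OF exp_convex]) auto
  then show ?thesis by (simp add: algebra_simps)
qed

text \<open>A failure puts the sample into one of four events: a tilted sum of either sign is too
  large, or the sum of squares is far below or far above its mean. The factor \<open>1 + v\<close>
  in the linear term is affordable because normalising a variable bounded by \<open>B\<close> leaves
  \<open>(1 + v) * b \<le> 2 * B\<close> for the scale \<open>b\<close>.\<close>

lemma empirical_bernstein_centered:
  fixes \<xi> :: "'a \<Rightarrow> real" and n :: nat and x v :: real
  assumes M: "prob_space M" and \<xi>[measurable]: "\<xi> \<in> borel_measurable M"
    and bd: "AE y in M. \<bar>\<xi> y\<bar> \<le> 1" and mean: "(\<integral>y. \<xi> y \<partial>M) = 0"
    and v: "v = (\<integral>y. (\<xi> y)\<^sup>2 \<partial>M)" and n: "1 \<le> n" and x: "6 \<le> exp x"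
  defines "P \<equiv> PiM {..<n} (\<lambda>_. M)" and "\<Delta> \<equiv> \<lambda>\<omega>. (\<Sum>j<n. \<xi> (\<omega> j)) / n"
  shows "measure P {\<omega> \<in> space P. sqrt ((\<Sum>j<n. (\<xi> (\<omega> j) - \<Delta> \<omega>)\<^sup>2) / n) * sqrt (2 * (x / n))
      + 3/2 * (1 + v) * (x / n) < \<bar>\<Delta> \<omega>\<bar>} \<le> 3 * exp (- x)"
    (is "measure P ?B \<le> _")
proof -
  interpret M: prob_space M by fact
  interpret P: product_prob_space "\<lambda>_. M" "{..<n}" by standard
  interpret P': prob_space P unfolding P_def by (rule P.prob_space_axioms)
  have v0: "0 \<le> v" unfolding v by simp
  have x0: "1 < x"
  proof (rule ccontr)
    assume "\<not> 1 < x"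
    then have "exp x \<le> exp 1" by simp
    also have "\<dots> \<le> 3" by (rule exp_le)
    finally show False using x by simp
  qed
  have n0: "0 < real n" using n by simp
  define L A where "L = x / n" and "A = v / L"
  have L0: "0 < L" using x0 n0 by (simp add: L_def)
  have nL: "n * L = x" using n0 by (simp add: L_def)
  have nv: "n * v = x * A" unfolding A_def nL[symmetric] using L0 by simp
  have A0: "0 \<le> A" using v0 L0 by (simp add: A_def)
  \<comment> \<open>\<open>\<rho>\<^sup>2 * x\<close> is the lower threshold for the sum of squares.
    With \<open>a = 71/50\<close>, slightly above \<open>sqrt 2\<close>, the equation is
    \<open>A = \<rho>\<^sup>2 + a * \<rho> + a\<^sup>2 / 2\<close>, which makes the lower tail cost
    \<open>exp (- (a\<^sup>2 / 2) * x)\<close>. For small \<open>A\<close> no threshold is imposed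
    and \<open>\<rho> = 0\<close>.\<close>
  obtain \<rho> where \<rho>: "0 \<le> \<rho>" "A \<le> \<rho>\<^sup>2 + 71/50 * \<rho> + 5041/5000"
      "\<rho> = 0 \<or> A = \<rho>\<^sup>2 + 71/50 * \<rho> + 5041/5000"
  proof (cases "A \<le> 5041/5000")
    case True
    then show ?thesis using that[of 0] by simp
  next
    case False
    define s where "s = sqrt (A - 5041/10000)"
    have s: "s\<^sup>2 = A - 5041/10000" using False by (simp add: s_def)
    have "71/100 \<le> s" unfolding s_def by (rule real_le_rsqrt) (use False in \<open>simp add: power2_eq_square\<close>)
    moreover have "(s - 71/100)\<^sup>2 + 71/50 * (s - 71/100) + 5041/5000 = A"
      using s by (simp add: power2_eq_square field_simps)
    ultimately show ?thesis using that[of "s - 71/100"] by simp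
  qed
  \<comment> \<open>For large \<open>A = n * v / x\<close>, \<open>\<tau>\<close> is close to
    \<open>sqrt A\<close>, so \<open>\<theta>\<close> is close to the classical tilt
    \<open>sqrt (2 * x / (n * v))\<close>; for small variance it stays bounded.\<close>
  define \<tau> \<theta> where "\<tau> = \<rho> + 7/10" and "\<theta> = sqrt 2 / \<tau>"
  define Q where "Q = (\<lambda>\<omega>. \<Sum>j<n. (\<xi> (\<omega> j))\<^sup>2)"
  have \<tau>A: "5 \<le> 16 * \<tau>\<^sup>2 - 2 * A"
  proof -
    have "\<tau>\<^sup>2 = \<rho>\<^sup>2 + 7/5 * \<rho> + 49/100"
      unfolding \<tau>_def by (simp add: power2_eq_square field_simps)
    then show ?thesis using \<rho>(1,2) zero_le_power2[of \<rho>] by linarith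
  qed
  \<comment> \<open>The subtracted squares produce the empirical second moment and the threshold
    contains the true one; \<open>b\<close> is the sign of the deviation to be detected. The
    conjunct \<open>0 < \<rho>\<close> in \<open>E2\<close> below empties that event when there is
    no lower threshold.\<close>
  define E1 where "E1 = (\<lambda>b. {\<omega> \<in> space P. n * (\<theta>\<^sup>2 / 3 * v) + x \<le> (\<Sum>j<n. b * \<theta> * \<xi> (\<omega> j) - (b * \<theta> * \<xi> (\<omega> j))\<^sup>2 / 6)})"
  define E2 where "E2 = {\<omega> \<in> space P. 0 < \<rho> \<and> Q \<omega> \<le> \<rho>\<^sup>2 * x}"
  define E3 where "E3 = {\<omega> \<in> space P. 16 * \<tau>\<^sup>2 * x \<le> Q \<omega>}"
  have meas[measurable]: "E1 b \<in> sets P" "E2 \<in> sets P" "E3 \<in> sets P" for b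
    unfolding E1_def E2_def E3_def Q_def P_def by measurable
  have sq_AE: "AE y in M. 0 \<le> (\<xi> y)\<^sup>2 \<and> (\<xi> y)\<^sup>2 \<le> 1"
    using bd by eventually_elim (simp add: abs_square_le_1)

  have E1: "measure P (E1 b) \<le> exp (- x)" if b: "b\<^sup>2 = 1" for b
  proof -
    have "(\<integral>\<^sup>+y. exp (b * \<theta> * \<xi> y - (b * \<theta> * \<xi> y)\<^sup>2 / 6) \<partial>M) \<le> exp (\<theta>\<^sup>2 / 3 * v)"
      unfolding v
    proof (rule mgf_le_of_quadratic[OF M \<xi> bd mean])
      show "AE y in M. exp (b * \<theta> * \<xi> y - (b * \<theta> * \<xi> y)\<^sup>2 / 6) \<le> 1 + b * \<theta> * \<xi> y + \<theta>\<^sup>2 / 3 * (\<xi> y)\<^sup>2"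
        using exp_le_quadratic[of "b * \<theta> * \<xi> y" for y] b by (auto simp: power_mult_distrib)
    qed
    from chernoff_PiM[OF M _ _ this, of "{..<n}" "n * (\<theta>\<^sup>2 / 3 * v) + x"]
    show ?thesis by (simp add: E1_def P_def)
  qed
  have E2: "measure P E2 \<le> exp (- (5041/5000) * x)"
  proof (cases "\<rho> = 0")
    case True
    then show ?thesis by (simp add: E2_def)
  next
    case False
    then have \<rho>0: "0 < \<rho>" and A: "A = \<rho>\<^sup>2 + 71/50 * \<rho> + 5041/5000" using \<rho> by auto
    \<comment> \<open>The optimal Chernoff parameter: \<open>exp \<beta>\<close> is the ratio of the
      mean \<open>n * v = x * A\<close> of \<open>Q\<close> to the threshold
      \<open>\<rho>\<^sup>2 * x\<close>.\<close>
    define \<beta> where "\<beta> = ln (A / \<rho>\<^sup>2)"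
    have "\<rho>\<^sup>2 < A" using A \<rho>0 by simp
    moreover have "0 < \<rho>\<^sup>2" using \<rho>0 by simp
    ultimately have A0: "0 < A" and "1 < A / \<rho>\<^sup>2" using \<rho>0
      by (linarith, simp)
    then have \<beta>0: "0 < \<beta>" and e\<beta>: "exp \<beta> = A / \<rho>\<^sup>2"
      unfolding \<beta>_def by (auto intro: less_trans[of 0 1])
    \<comment> \<open>The quadratic defining \<open>\<rho>\<close> is chosen so that
      \<open>A / \<rho>\<^sup>2\<close> is the second Taylor polynomial of \<open>exp\<close> at
      \<open>71/50 / \<rho>\<close>.\<close>
    have \<beta>_le: "\<rho>\<^sup>2 * \<beta> \<le> 71/50 * \<rho>"
    proof -
      have "A / \<rho>\<^sup>2 = 1 + 71/50 / \<rho> + (71/50 / \<rho>)\<^sup>2 / 2"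
        unfolding A using \<rho>0 by (simp add: power2_eq_square field_simps)
      also have "\<dots> \<le> exp (71/50 / \<rho>)"
        by (rule exp_lower_Taylor_quadratic) (use \<rho>0 in simp)
      finally have "\<beta> \<le> 71/50 / \<rho>" unfolding e\<beta>[symmetric] by simp
      then have "\<rho>\<^sup>2 * \<beta> \<le> \<rho>\<^sup>2 * (71/50 / \<rho>)" by (intro mult_left_mono) auto
      then show ?thesis using \<rho>0 by (simp add: power2_eq_square)
    qed
    have "(\<integral>\<^sup>+y. exp (- \<beta> * (\<xi> y)\<^sup>2) \<partial>M) \<le> exp ((exp (- \<beta>) - 1) * v)"
      unfolding v
    proof (rule mgf_le_of_quadratic[OF M \<xi> bd mean])
      show "AE y in M. exp (- \<beta> * (\<xi> y)\<^sup>2) \<le> 1 + 0 * \<xi> y + (exp (- \<beta>) - 1) * (\<xi> y)\<^sup>2"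
        using sq_AE by eventually_elim (use exp_le_chord[of _ "- \<beta>"] in auto)
    qed
    from chernoff_PiM[OF M _ _ this, of "{..<n}" "- \<beta> * (\<rho>\<^sup>2 * x)"]
    have "measure P {\<omega> \<in> space P. - \<beta> * (\<rho>\<^sup>2 * x) \<le> (\<Sum>j<n. - \<beta> * (\<xi> (\<omega> j))\<^sup>2)}
        \<le> exp (n * ((exp (- \<beta>) - 1) * v) - - \<beta> * (\<rho>\<^sup>2 * x))"
      by (simp add: P_def)
    also have "{\<omega> \<in> space P. - \<beta> * (\<rho>\<^sup>2 * x) \<le> (\<Sum>j<n. - \<beta> * (\<xi> (\<omega> j))\<^sup>2)} = E2"
      unfolding E2_def Q_def using \<beta>0 \<rho>0 by (auto simp: sum_distrib_left[symmetric] sum_negf)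
    also have "n * ((exp (- \<beta>) - 1) * v) - - \<beta> * (\<rho>\<^sup>2 * x) = x * (\<rho>\<^sup>2 * \<beta> - (A - \<rho>\<^sup>2))"
    proof -
      have "n * ((exp (- \<beta>) - 1) * v) = (exp (- \<beta>) - 1) * (n * v)" by simp
      also have "\<dots> = x * (A * exp (- \<beta>) - A)" unfolding nv by (simp add: algebra_simps)
      also have "A * exp (- \<beta>) = \<rho>\<^sup>2" using A0 \<rho>0 by (simp add: exp_minus e\<beta>)
      finally show ?thesis by (simp add: algebra_simps)
    qed
    also have "\<dots> \<le> x * (- (5041/5000))"
      using \<beta>_le A x0 by (intro mult_left_mono) auto
    finally show ?thesis by (simp add: mult.commute)
  qed
  \<comment> \<open>The threshold is so far above the mean that the parameter 1 suffices, with
    \<open>exp 1 - 1 \<le> 2\<close>.\<close>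
  have E3: "measure P E3 \<le> exp (- 5 * x)"
  proof -
    have "(\<integral>\<^sup>+y. exp ((\<xi> y)\<^sup>2) \<partial>M) \<le> exp (2 * v)"
      unfolding v
    proof (rule mgf_le_of_quadratic[OF M \<xi> bd mean])
      show "AE y in M. exp ((\<xi> y)\<^sup>2) \<le> 1 + 0 * \<xi> y + 2 * (\<xi> y)\<^sup>2"
        using sq_AE
      proof eventually_elim
        case (elim y)
        then have "exp ((\<xi> y)\<^sup>2) \<le> 1 + (exp 1 - 1) * (\<xi> y)\<^sup>2" using exp_le_chord[of "(\<xi> y)\<^sup>2" 1] by simp
        also have "(exp 1 - 1) * (\<xi> y)\<^sup>2 \<le> 2 * (\<xi> y)\<^sup>2" using exp_le by (intro mult_right_mono) auto
        finally show ?case by simp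
      qed
    qed
    from chernoff_PiM[OF M _ _ this, of "{..<n}" "16 * \<tau>\<^sup>2 * x"]
    have "measure P E3 \<le> exp (n * (2 * v) - 16 * \<tau>\<^sup>2 * x)"
      by (simp add: P_def E3_def Q_def)
    also have "n * (2 * v) - 16 * \<tau>\<^sup>2 * x = - (16 * \<tau>\<^sup>2 - 2 * A) * x"
      using nv by (simp add: algebra_simps)
    also have "\<dots> \<le> - 5 * x" using \<tau>A x0 by (intro mult_right_mono) auto
    finally show ?thesis by simp
  qed

  \<comment> \<open>The excess of \<open>5041/5000\<close> over 1, together with
    \<open>1 < x\<close>, leaves a fraction \<open>41/5041\<close> of \<open>exp (- x)\<close> for
    the upper tail, which needs at most \<open>1/1296\<close> of it.\<close>
  have small: "exp (- (5041/5000) * x) + exp (- 5 * x) \<le> exp (- x)"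
  proof -
    have "exp (- (5041/5000) * x) = exp (- x) * exp (- (41/5000) * x)"
      unfolding exp_add[symmetric] by (simp add: field_simps)
    moreover have "exp (- 5 * x) = exp (- x) * exp (- 4 * x)"
      unfolding exp_add[symmetric] by simp
    moreover have "exp (- (41/5000) * x) \<le> 5000/5041"
    proof -
      have "exp (- (41/5000) * x) = inverse (exp (41/5000 * x))" by (simp add: exp_minus)
      also have "\<dots> \<le> inverse (5041/5000)"
      proof (rule le_imp_inverse_le)
        have "5041/5000 \<le> 1 + 41/5000 * x" using x0 by simp
        also have "\<dots> \<le> exp (41/5000 * x)" by (rule exp_ge_add_one_self)
        finally show "5041/5000 \<le> exp (41/5000 * x)" .
      qed simp
      finally show ?thesis by simp
    qed
    moreover have "exp (- 4 * x) \<le> 1/1296"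
    proof -
      have "exp (- 4 * x) = inverse (exp x ^ 4)" by (simp add: exp_minus exp_of_nat_mult[symmetric])
      also have "\<dots> \<le> inverse (6 ^ 4)"
        using x by (intro le_imp_inverse_le power_mono) auto
      finally show ?thesis by simp
    qed
    ultimately have "exp (- (5041/5000) * x) + exp (- 5 * x) = exp (- x) * (exp (- (41/5000) * x) + exp (- 4 * x))"
      and "exp (- (41/5000) * x) + exp (- 4 * x) \<le> 1" by (simp_all add: algebra_simps)
    then show ?thesis by (metis exp_ge_zero mult.right_neutral mult_left_mono)
  qed

  have bdP: "AE \<omega> in P. \<forall>j<n. \<bar>\<xi> (\<omega> j)\<bar> \<le> 1"
    unfolding P_def AE_all_countable
  proof (intro allI)
    show "AE \<omega> in PiM {..<n} (\<lambda>_. M). j < n \<longrightarrow> \<bar>\<xi> (\<omega> j)\<bar> \<le> 1" for j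
    proof (cases "j < n")
      case True
      have "AE \<omega> in PiM {..<n} (\<lambda>_. M). \<bar>\<xi> (\<omega> j)\<bar> \<le> 1"
        by (rule AE_PiM_component[of "{..<n}" "\<lambda>_. M" j "\<lambda>y. \<bar>\<xi> y\<bar> \<le> 1"]) (use M bd True in auto)
      then show ?thesis by eventually_elim simp
    qed simp
  qed
  \<comment> \<open>The inclusion holds only almost everywhere, since
    \<open>\<bar>\<Delta> \<omega>\<bar> \<le> 1\<close> needs the bound on \<open>\<xi>\<close> at
    the sampled points.\<close>
  have incl: "AE \<omega> in P. \<omega> \<in> ?B \<longrightarrow> \<omega> \<in> (E1 1 \<union> E1 (- 1)) \<union> (E2 \<union> E3)"
    using bdP
  proof eventually_elim
    case (elim \<omega>)
    note bd = elim
    show ?case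
    proof (intro impI, rule ccontr)
      assume "\<omega> \<in> ?B" and not: "\<omega> \<notin> (E1 1 \<union> E1 (- 1)) \<union> (E2 \<union> E3)"
      define S where "S = (\<Sum>j<n. (\<xi> (\<omega> j) - \<Delta> \<omega>)\<^sup>2) / n"
      have \<omega>: "\<omega> \<in> space P" and B: "sqrt S * sqrt (2 * L) + 3/2 * (1 + v) * L < \<bar>\<Delta> \<omega>\<bar>"
        using \<open>\<omega> \<in> ?B\<close> by (auto simp: S_def L_def)
      have sum\<xi>: "(\<Sum>j<n. \<xi> (\<omega> j)) = n * \<Delta> \<omega>" using n0 by (simp add: \<Delta>_def)
      have S: "Q \<omega> / n = S + \<bar>\<Delta> \<omega>\<bar>\<^sup>2"
      proof -
        have "(\<Sum>j<n. (\<xi> (\<omega> j) - \<Delta> \<omega>)\<^sup>2) = Q \<omega> - 2 * \<Delta> \<omega> * (\<Sum>j<n. \<xi> (\<omega> j)) + n * (\<Delta> \<omega>)\<^sup>2"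
          by (simp add: Q_def power2_diff sum.distrib sum_subtractf sum_distrib_left mult_ac)
        then show ?thesis using n0 unfolding sum\<xi> S_def by (simp add: power2_eq_square field_simps)
      qed
      have \<Delta>1: "\<bar>\<Delta> \<omega>\<bar> \<le> 1"
      proof -
        have "\<bar>\<Sum>j<n. \<xi> (\<omega> j)\<bar> \<le> (\<Sum>j<n. 1)" by (rule order_trans[OF sum_abs sum_mono]) (use bd in auto)
        then show ?thesis using n0 by (simp add: \<Delta>_def)
      qed
      have Q1: "\<rho>\<^sup>2 * x \<le> Q \<omega>"
      proof (cases "\<rho> = 0")
        case True then show ?thesis by (auto simp: Q_def intro: sum_nonneg)
      next
        case False then show ?thesis using not \<omega> \<rho>(1) by (auto simp: E2_def)
      qed
      have Q2: "Q \<omega> \<le> 16 * \<tau>\<^sup>2 * x" using not \<omega> by (auto simp: E3_def)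
      have "L \<le> \<theta> * \<bar>\<Delta> \<omega>\<bar> - \<theta>\<^sup>2 / 6 * (Q \<omega> / n) - \<theta>\<^sup>2 / 3 * v"
        unfolding \<theta>_def
      proof (rule failure_implies_tilt[OF L0 v0 \<rho>(1) \<rho>(2)[unfolded A_def] \<rho>(3)[unfolded A_def] \<tau>_def _ S])
        show "0 \<le> S" unfolding S_def by (intro divide_nonneg_nonneg sum_nonneg) auto
        show "\<rho>\<^sup>2 * L \<le> Q \<omega> / n" using Q1 n0 by (simp add: L_def divide_right_mono)
        show "Q \<omega> / n \<le> 16 * \<tau>\<^sup>2 * L" using Q2 n0 by (simp add: L_def divide_right_mono)
      qed (use \<Delta>1 B in auto)
      then have "n * L \<le> n * (\<theta> * \<bar>\<Delta> \<omega>\<bar> - \<theta>\<^sup>2 / 6 * (Q \<omega> / n) - \<theta>\<^sup>2 / 3 * v)"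
        by (intro mult_left_mono) auto
      also have "\<dots> = \<theta> * (n * \<bar>\<Delta> \<omega>\<bar>) - \<theta>\<^sup>2 / 6 * Q \<omega> - n * (\<theta>\<^sup>2 / 3 * v)"
        using n0 by (simp add: field_simps)
      finally have key: "n * (\<theta>\<^sup>2 / 3 * v) + x \<le> \<theta> * (n * \<bar>\<Delta> \<omega>\<bar>) - \<theta>\<^sup>2 / 6 * Q \<omega>"
        unfolding nL by simp
      \<comment> \<open>The sign of the deviation selects which of the two tilted sums is
        large.\<close>
      define b :: real where "b = (if 0 \<le> \<Delta> \<omega> then 1 else - 1)"
      have b2: "b\<^sup>2 = 1" and b\<Delta>: "\<bar>\<Delta> \<omega>\<bar> = b * \<Delta> \<omega>" by (auto simp: b_def)
      have "(\<Sum>j<n. b * \<theta> * \<xi> (\<omega> j) - (b * \<theta> * \<xi> (\<omega> j))\<^sup>2 / 6) = \<theta> * (n * \<bar>\<Delta> \<omega>\<bar>) - \<theta>\<^sup>2 / 6 * Q \<omega>"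
        unfolding b\<Delta> Q_def using sum\<xi> b2
        by (simp add: sum_subtractf power_mult_distrib sum_distrib_left[symmetric] sum_divide_distrib[symmetric])
      with key \<omega> have "\<omega> \<in> E1 b" by (simp add: E1_def)
      with not show False by (auto simp: b_def split: if_splits)
    qed
  qed
  have "measure P ?B \<le> measure P ((E1 1 \<union> E1 (- 1)) \<union> (E2 \<union> E3))"
    by (rule P'.finite_measure_mono_AE[OF incl]) auto
  also have "\<dots> \<le> (measure P (E1 1) + measure P (E1 (- 1))) + (measure P E2 + measure P E3)"
    by (intro order_trans[OF measure_Un_le] add_mono order_refl) auto
  also have "\<dots> \<le> 3 * exp (- x)"
    using E1[of 1] E1[of "- 1"] E2 E3 small by simp
  finally show ?thesis .
qed

text \<open>Dividing \<open>f - \<mu>\<close> by \<open>b = B + \<bar>\<mu>\<bar>\<close> gives a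
  centred variable bounded by 1 whose variance \<open>v\<close> is at most \<open>(B\<^sup>2 -
  \<mu>\<^sup>2) / b\<^sup>2 = (B - \<bar>\<mu>\<bar>) / b\<close>. Hence
  \<open>(1 + v) * b \<le> 2 * B\<close>, and the linear coefficient \<open>3/2 * (1 + v)\<close>
  scales back to at most \<open>3 * B\<close>.\<close>

lemma empirical_bernstein:
  fixes f :: "'a \<Rightarrow> real" and n :: nat and x B :: real
  assumes M: "prob_space M" and f[measurable]: "f \<in> borel_measurable M"
    and bd: "AE y in M. \<bar>f y\<bar> \<le> B" and n: "1 \<le> n" and x: "6 \<le> exp x"
  defines "P \<equiv> PiM {..<n} (\<lambda>_. M)" and "\<mu> \<equiv> \<integral>y. f y \<partial>M" and "avg \<equiv> \<lambda>\<omega>. (\<Sum>j<n. f (\<omega> j)) / n"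
  shows "measure P {\<omega> \<in> space P. sqrt ((\<Sum>j<n. (f (\<omega> j) - avg \<omega>)\<^sup>2) / n) * sqrt (2 * (x / n))
      + 3 * B * (x / n) < \<bar>avg \<omega> - \<mu>\<bar>} \<le> 3 * exp (- x)"
    (is "measure P ?B \<le> _")
proof -
  interpret M: prob_space M by fact
  interpret P: product_prob_space "\<lambda>_. M" "{..<n}" by standard
  interpret P': prob_space P unfolding P_def by (rule P.prob_space_axioms)
  have n0: "0 < real n" using n by simp
  have x0: "0 < x"
  proof (rule ccontr)
    assume "\<not> 0 < x"
    then have "exp x \<le> 1" by simp
    with x show False by simp
  qed
  have i1: "integrable M f"
    by (rule M.integrable_const_bound[of _ B]) (use bd in auto)
  have sqbd: "AE y in M. (f y)\<^sup>2 \<le> B\<^sup>2"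
    using bd by eventually_elim (simp add: abs_le_square_iff[symmetric])
  have i2: "integrable M (\<lambda>y. (f y)\<^sup>2)"
    by (rule M.integrable_const_bound[of _ "B\<^sup>2"]) (use sqbd in auto)
  have \<mu>B: "\<bar>\<mu>\<bar> \<le> B"
  proof -
    have "\<bar>\<mu>\<bar> \<le> (\<integral>y. \<bar>f y\<bar> \<partial>M)" unfolding \<mu>_def by (rule integral_abs_bound)
    also have "\<dots> \<le> (\<integral>y. B \<partial>M)" using i1 bd by (intro integral_mono_AE) auto
    finally show ?thesis by (simp add: M.prob_space)
  qed
  define b where "b = B + \<bar>\<mu>\<bar>"
  show ?thesis
  proof (cases "b = 0")
    \<comment> \<open>Normalisation is impossible here, but \<open>f\<close> vanishes almost
      everywhere and the strict inequality becomes \<open>0 < 0\<close>.\<close>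
    case True
    then have B0: "B = 0" "\<mu> = 0" using \<mu>B by (auto simp: b_def)
    have "AE \<omega> in P. f (\<omega> j) = 0" if "j < n" for j
      unfolding P_def
      by (rule AE_PiM_component[of "{..<n}" "\<lambda>_. M" j "\<lambda>y. f y = 0"]) (use M bd B0 that in auto)
    then have "AE \<omega> in P. \<forall>j\<in>{..<n}. f (\<omega> j) = 0" by (simp add: AE_ball_countable)
    then have "AE \<omega> in P. \<omega> \<in> ?B \<longrightarrow> \<omega> \<in> {}"
      by eventually_elim (simp add: avg_def B0)
    from P'.finite_measure_mono_AE[OF this] have "measure P ?B \<le> 0" by simp
    also have "0 \<le> 3 * exp (- x)" by simp
    finally show ?thesis .
  next
    case False
    then have b0: "0 < b" using \<mu>B by (simp add: b_def)
    define \<xi> v where "\<xi> = (\<lambda>y. (f y - \<mu>) / b)" and "v = (\<integral>y. (\<xi> y)\<^sup>2 \<partial>M)"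
    have \<xi>[measurable]: "\<xi> \<in> borel_measurable M" unfolding \<xi>_def by measurable
    have bd\<xi>: "AE y in M. \<bar>\<xi> y\<bar> \<le> 1"
      using bd by eventually_elim (use b0 in \<open>auto simp: \<xi>_def b_def\<close>)
    have mean: "(\<integral>y. \<xi> y \<partial>M) = 0"
      using i1 by (simp add: \<xi>_def \<mu>_def M.prob_space)
    have vB: "(1 + v) * b \<le> 2 * B"
    proof -
      have "v = (\<integral>y. (f y)\<^sup>2 - 2 * \<mu> * f y + \<mu>\<^sup>2 \<partial>M) / b\<^sup>2"
        unfolding v_def \<xi>_def by (simp add: power_divide power2_diff algebra_simps)
      also have "(\<integral>y. (f y)\<^sup>2 - 2 * \<mu> * f y + \<mu>\<^sup>2 \<partial>M) = (\<integral>y. (f y)\<^sup>2 \<partial>M) - \<mu>\<^sup>2"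
        using i1 i2 by (simp add: M.prob_space \<mu>_def[symmetric] power2_eq_square)
      finally have "v * b\<^sup>2 = (\<integral>y. (f y)\<^sup>2 \<partial>M) - \<mu>\<^sup>2" using b0 by simp
      also have "(\<integral>y. (f y)\<^sup>2 \<partial>M) \<le> (\<integral>y. B\<^sup>2 \<partial>M)" using i2 sqbd by (intro integral_mono_AE) auto
      also have "(\<integral>y. B\<^sup>2 \<partial>M) - \<mu>\<^sup>2 = (B - \<bar>\<mu>\<bar>) * b"
        by (simp add: M.prob_space b_def power2_eq_square algebra_simps)
      finally have "v * b * b \<le> (B - \<bar>\<mu>\<bar>) * b" by (simp add: power2_eq_square mult.assoc)
      then have "v * b \<le> B - \<bar>\<mu>\<bar>" using b0 by simp
      then show ?thesis by (simp add: b_def algebra_simps)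
    qed
    define \<Delta> where "\<Delta> = (\<lambda>\<omega>. (\<Sum>j<n. \<xi> (\<omega> j)) / n)"
    have \<Delta>: "\<Delta> \<omega> = (avg \<omega> - \<mu>) / b" for \<omega>
      using n0 by (simp add: \<Delta>_def \<xi>_def avg_def sum_divide_distrib[symmetric] sum_subtractf field_simps)
    have "?B \<subseteq> {\<omega> \<in> space P. sqrt ((\<Sum>j<n. (\<xi> (\<omega> j) - \<Delta> \<omega>)\<^sup>2) / n) * sqrt (2 * (x / n))
        + 3/2 * (1 + v) * (x / n) < \<bar>\<Delta> \<omega>\<bar>}" (is "_ \<subseteq> ?C")
    proof (intro subsetI CollectI conjI)
      fix \<omega> assume \<omega>: "\<omega> \<in> ?B"
      then show "\<omega> \<in> space P" by simp
      define s where "s = sqrt ((\<Sum>j<n. (f (\<omega> j) - avg \<omega>)\<^sup>2) / n)"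
      have "(\<Sum>j<n. (\<xi> (\<omega> j) - \<Delta> \<omega>)\<^sup>2) / n = ((\<Sum>j<n. (f (\<omega> j) - avg \<omega>)\<^sup>2) / n) / b\<^sup>2"
        unfolding \<Delta> \<xi>_def by (simp add: diff_divide_distrib[symmetric] power_divide sum_divide_distrib[symmetric])
      then have s: "sqrt ((\<Sum>j<n. (\<xi> (\<omega> j) - \<Delta> \<omega>)\<^sup>2) / n) = s / b"
        using b0 by (simp only: s_def real_sqrt_divide[of _ "b\<^sup>2"] real_sqrt_abs abs_of_pos)
      have "3/2 * (1 + v) \<le> 3 * B / b" using vB b0 by (simp add: field_simps)
      then have "3/2 * (1 + v) * (x / n) \<le> 3 * B / b * (x / n)"
        using x0 n0 by (intro mult_right_mono) auto
      then have "s / b * sqrt (2 * (x / n)) + 3/2 * (1 + v) * (x / n)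
          \<le> (s * sqrt (2 * (x / n)) + 3 * B * (x / n)) / b"
        by (simp add: add_divide_distrib mult_ac)
      also have "\<dots> < \<bar>avg \<omega> - \<mu>\<bar> / b"
        using \<omega> b0 by (intro divide_strict_right_mono) (auto simp: s_def)
      also have "\<dots> = \<bar>\<Delta> \<omega>\<bar>" using b0 by (simp add: \<Delta>)
      finally show "sqrt ((\<Sum>j<n. (\<xi> (\<omega> j) - \<Delta> \<omega>)\<^sup>2) / n) * sqrt (2 * (x / n))
        + 3/2 * (1 + v) * (x / n) < \<bar>\<Delta> \<omega>\<bar>" unfolding s .
    qed
    moreover have "?C \<in> sets P" unfolding P_def \<Delta>_def by measurable
    ultimately have "measure P ?B \<le> measure P ?C" by (intro P'.finite_measure_mono)
    also have "\<dots> \<le> 3 * exp (- x)"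
      using empirical_bernstein_centered[OF M \<xi> bd\<xi> mean v_def n x] by (simp add: P_def \<Delta>_def)
    finally show ?thesis .
  qed
qed

section \<open>Hoeffding's inequality for the mean of an i.i.d. sample\<close>

text \<open>The Chernoff bound for \<open>g\<close> and \<open>- g\<close>, with Hoeffding's lemma
  supplying the exponential moment.\<close>

lemma hoeffding_PiM:
  fixes g :: "'a \<Rightarrow> real" and m :: nat and c \<epsilon> :: real
  assumes M: "prob_space M" and g[measurable]: "g \<in> borel_measurable M"
    and bd: "AE y in M. 0 \<le> g y \<and> g y \<le> c" and c: "0 < c" and m: "1 \<le> m" and \<epsilon>: "0 < \<epsilon>"
  defines "P \<equiv> PiM {..<m} (\<lambda>_. M)"
  shows "measure P {\<omega> \<in> space P. \<epsilon> < \<bar>(\<integral>y. g y \<partial>M) - (\<Sum>i<m. g (\<omega> i)) / m\<bar>}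
    \<le> 2 * exp (- 2 * m * \<epsilon>\<^sup>2 / c\<^sup>2)" (is "measure P ?B \<le> _")
proof -
  interpret M: prob_space M by fact
  interpret P: product_prob_space "\<lambda>_. M" "{..<m}" by standard
  interpret P': prob_space P unfolding P_def by (rule P.prob_space_axioms)
  define \<mu> where "\<mu> = (\<integral>y. g y \<partial>M)"
  have m0: "0 < real m" using m by simp
  \<comment> \<open>The minimiser of the exponent
    \<open>t\<^sup>2 * c\<^sup>2 / 8 - t * \<epsilon>\<close>.\<close>
  define t where "t = 4 * \<epsilon> / c\<^sup>2"
  have t0: "0 < t" using \<epsilon> c by (simp add: t_def)
  define E where "E = (\<lambda>b. {\<omega> \<in> space P. m * (t * \<epsilon>) \<le> (\<Sum>i<m. t * (b * g (\<omega> i) - b * \<mu>))})"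
  have meas[measurable]: "E b \<in> sets P" for b unfolding E_def P_def by measurable
  have E: "measure P (E b) \<le> exp (- 2 * m * \<epsilon>\<^sup>2 / c\<^sup>2)" if b: "b = 1 \<or> b = - 1" for b
  proof -
    define a where "a = (if b = 1 then 0 else - c)"
    interpret I: interval_bounded_random_variable M "\<lambda>y. b * g y" a "a + c"
      by unfold_locales (use bd b in \<open>auto simp: a_def\<close>)
    have e: "(\<integral>y. b * g y \<partial>M) = b * \<mu>" by (simp add: \<mu>_def)
    have "(\<integral>\<^sup>+y. exp (t * (b * g y - b * \<mu>)) \<partial>M) \<le> exp (t\<^sup>2 * c\<^sup>2 / 8)"
      using I.Hoeffdings_lemma_nn_integral[OF t0] unfolding e by simp
    from chernoff_PiM[OF M _ _ this, of "{..<m}" "m * (t * \<epsilon>)"]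
    have "measure P (E b) \<le> exp (m * (t\<^sup>2 * c\<^sup>2 / 8) - m * (t * \<epsilon>))"
      by (simp add: E_def P_def)
    also have "m * (t\<^sup>2 * c\<^sup>2 / 8) - m * (t * \<epsilon>) = - 2 * m * \<epsilon>\<^sup>2 / c\<^sup>2"
      unfolding t_def using c by (simp add: power2_eq_square field_simps)
    finally show ?thesis .
  qed
  have "?B \<subseteq> E 1 \<union> E (- 1)"
  proof
    fix \<omega> assume "\<omega> \<in> ?B"
    then have \<omega>: "\<omega> \<in> space P" and gt: "\<epsilon> < \<bar>\<mu> - (\<Sum>i<m. g (\<omega> i)) / m\<bar>" by (auto simp: \<mu>_def)
    have "m * \<epsilon> < m * \<bar>\<mu> - (\<Sum>i<m. g (\<omega> i)) / m\<bar>" using gt m0 by simp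
    also have "\<dots> = \<bar>m * (\<mu> - (\<Sum>i<m. g (\<omega> i)) / m)\<bar>" by (simp add: abs_mult)
    also have "m * (\<mu> - (\<Sum>i<m. g (\<omega> i)) / m) = m * \<mu> - (\<Sum>i<m. g (\<omega> i))"
      using m0 by (simp add: field_simps)
    finally have "m * \<epsilon> \<le> (\<Sum>i<m. g (\<omega> i)) - m * \<mu> \<or> m * \<epsilon> \<le> m * \<mu> - (\<Sum>i<m. g (\<omega> i))" by linarith
    then have "t * (m * \<epsilon>) \<le> t * ((\<Sum>i<m. g (\<omega> i)) - m * \<mu>) \<or> t * (m * \<epsilon>) \<le> t * (m * \<mu> - (\<Sum>i<m. g (\<omega> i)))"
      using t0 by simp
    then show "\<omega> \<in> E 1 \<union> E (- 1)"
      using \<omega> by (simp add: E_def sum_distrib_left[symmetric] sum_subtractf sum_negf sum.distrib algebra_simps)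
  qed
  then have "measure P ?B \<le> measure P (E 1 \<union> E (- 1))" by (intro P'.finite_measure_mono) auto
  also have "\<dots> \<le> measure P (E 1) + measure P (E (- 1))" by (intro measure_Un_le) auto
  also have "\<dots> \<le> 2 * exp (- 2 * m * \<epsilon>\<^sup>2 / c\<^sup>2)" using E[of 1] E[of "- 1"] by simp
  finally show ?thesis .
qed

section \<open>Discounted returns: measurability and size\<close>

lemma reward_at_measurable: "k \<in> I \<Longrightarrow> (\<lambda>\<omega>. reward_at \<omega> k) \<in> borel_measurable (PiM I (\<lambda>_. step_space S A))"
  unfolding reward_at_def step_space_def by measurable

lemma truncated_return_measurable:
  "{..<l} \<subseteq> I \<Longrightarrow> truncated_return \<gamma> l \<in> borel_measurable (PiM I (\<lambda>_. step_space S A))"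
  unfolding truncated_return_def[abs_def]
  by (intro borel_measurable_sum borel_measurable_times reward_at_measurable) auto

lemma discounted_return_measurable:
  "(\<lambda>\<omega>. \<Sum>k. \<gamma> ^ k * reward_at \<omega> k) \<in> borel_measurable (PiM UNIV (\<lambda>_. step_space S A))"
  by (intro borel_measurable_suminf borel_measurable_times reward_at_measurable) auto

lemma truncated_return_restrict: "truncated_return \<gamma> l (restrict \<omega> {..<l}) = truncated_return \<gamma> l \<omega>"
  by (simp add: truncated_return_def reward_at_def)

lemma abs_truncated_return_le:
  fixes \<gamma> R :: real
  assumes "0 < \<gamma>" "\<gamma> < 1" "\<And>k. k < l \<Longrightarrow> \<bar>reward_at \<omega> k\<bar> \<le> R"
  shows "\<bar>truncated_return \<gamma> l \<omega>\<bar> \<le> R * ((1 - \<gamma> ^ l) / (1 - \<gamma>))"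
proof -
  have "\<bar>truncated_return \<gamma> l \<omega>\<bar> \<le> (\<Sum>k<l. \<gamma> ^ k * R)"
    unfolding truncated_return_def
    by (rule order_trans[OF sum_abs sum_mono]) (use assms in \<open>auto simp: abs_mult intro!: mult_left_mono\<close>)
  also have "\<dots> = R * ((1 - \<gamma> ^ l) / (1 - \<gamma>))"
    using assms by (simp add: sum_distrib_right[symmetric] sum_gp_strict)
  finally show ?thesis .
qed

lemma rollout_return_measurable:
  "j < n \<Longrightarrow> (\<lambda>p. truncated_return \<gamma> l (snd p j)) \<in> borel_measurable (data_point_space S A l n)"
  unfolding data_point_space_def
  by (rule measurable_compose[OF _ truncated_return_measurable[OF order_refl]]) measurable

section \<open>Rewards and values along trajectories of the decision process\<close>

context
  fixes S :: "'s measure" and A :: "'a measure"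
    and T :: "'s \<times> 'a \<Rightarrow> (real \<times> 's) measure" and \<pi> :: "'s \<Rightarrow> 'a measure"
  assumes T: "T \<in> S \<Otimes>\<^sub>M A \<rightarrow>\<^sub>M prob_algebra (borel \<Otimes>\<^sub>M S)"
    and \<pi>: "\<pi> \<in> S \<rightarrow>\<^sub>M prob_algebra A"
begin

lemma trajectory_law_prob_space:
  assumes "s \<in> space S"
  shows "prob_space (trajectory_law S A T \<pi> s)"
    and "sets (trajectory_law S A T \<pi> s) = sets (PiM UNIV (\<lambda>_. step_space S A))"
  using measurable_space[OF trajectory_law_measurable[OF T \<pi>] assms] by (auto simp: space_prob_algebra)

lemma rollout_law_prob_space:
  assumes "s \<in> space S"
  shows "prob_space (rollout_law S A T \<pi> l s)"
    and "sets (rollout_law S A T \<pi> l s) = sets (PiM {..<l} (\<lambda>_. step_space S A))"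
  using measurable_space[OF rollout_law_measurable[OF T \<pi>] assms] by (auto simp: space_prob_algebra)

lemma restrict_trajectory_measurable:
  assumes "s \<in> space S"
  shows "(\<lambda>\<omega>. restrict \<omega> {..<l}) \<in> trajectory_law S A T \<pi> s \<rightarrow>\<^sub>M PiM {..<l} (\<lambda>_. step_space S A)"
  by (subst measurable_cong_sets[OF trajectory_law_prob_space(2)[OF assms] refl])
     (rule measurable_restrict_subset, simp)

lemma policy_value_measurable: "policy_value S A T \<pi> \<gamma> \<in> borel_measurable S"
  unfolding policy_value_def[abs_def]
  by (rule measurable_compose[OF measurable_prob_algebraD[OF trajectory_law_measurable[OF T \<pi>]]
        integral_measurable_subprob_algebra[OF discounted_return_measurable]])

lemma expected_truncated_return_measurable:
  "(\<lambda>s. \<integral>\<omega>. truncated_return \<gamma> l \<omega> \<partial>rollout_law S A T \<pi> l s) \<in> borel_measurable S"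
  by (rule measurable_compose[OF measurable_prob_algebraD[OF rollout_law_measurable[OF T \<pi>]]
        integral_measurable_subprob_algebra[OF truncated_return_measurable]]) simp

context
  fixes Rmax :: real
  assumes Rmax: "\<And>s a. s \<in> space S \<Longrightarrow> a \<in> space A \<Longrightarrow> AE x in T (s, a). \<bar>fst x\<bar> \<le> Rmax"
begin

lemma AE_step_reward_le:
  assumes s: "s \<in> space S"
  shows "AE y in step_law S A T \<pi> s. \<bar>fst (snd y)\<bar> \<le> Rmax"
proof -
  have \<pi>s: "prob_space (\<pi> s)" "sets (\<pi> s) = sets A"
    using measurable_space[OF \<pi> s] by (auto simp: space_prob_algebra)
  have Ts: "(\<lambda>a. T (s, a)) \<in> A \<rightarrow>\<^sub>M prob_algebra (borel \<Otimes>\<^sub>M S)"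
    using measurable_compose[OF measurable_Pair1'[OF s] T] by simp
  have "(\<lambda>a. distr (T (s, a)) (step_space S A) (\<lambda>x. (a, x))) \<in> A \<rightarrow>\<^sub>M prob_algebra (step_space S A)"
    unfolding step_space_def by (rule measurable_distr_prob_space2[OF Ts]) simp
  then have K: "(\<lambda>a. distr (T (s, a)) (step_space S A) (\<lambda>x. (a, x))) \<in> \<pi> s \<rightarrow>\<^sub>M subprob_algebra (step_space S A)"
    using \<pi>s(2) by (subst measurable_cong_sets[OF _ refl]) (auto intro: measurable_prob_algebraD)
  have pred: "Measurable.pred (step_space S A) (\<lambda>y. \<bar>fst (snd y)\<bar> \<le> Rmax)"
    unfolding step_space_def by measurable
  have "AE a in \<pi> s. AE y in distr (T (s, a)) (step_space S A) (\<lambda>x. (a, x)). \<bar>fst (snd y)\<bar> \<le> Rmax"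
  proof (rule AE_I2)
    fix a assume "a \<in> space (\<pi> s)"
    then have a: "a \<in> space A" using sets_eq_imp_space_eq[OF \<pi>s(2)] by simp
    have setsT: "sets (T (s, a)) = sets (borel \<Otimes>\<^sub>M S)"
      using measurable_space[OF Ts a] by (simp add: space_prob_algebra)
    have "(\<lambda>x. (a, x)) \<in> T (s, a) \<rightarrow>\<^sub>M step_space S A"
      unfolding step_space_def using a by (subst measurable_cong_sets[OF setsT refl]) simp
    then show "AE y in distr (T (s, a)) (step_space S A) (\<lambda>x. (a, x)). \<bar>fst (snd y)\<bar> \<le> Rmax"
      using pred Rmax[OF s a] by (subst AE_distr_iff) (auto simp: pred_def)
  qed
  then show ?thesis
    unfolding step_law_def by (subst AE_bind[OF K pred])
qed

text \<open>The law of finitely many entries is an iterated composition of one-step kernels, the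
  last of which satisfies the bound at every past. The exceptional set is then pulled back to the
  projective limit, and countably many \<open>k\<close> are combined.\<close>

lemma AE_trajectory_reward_le:
  assumes s: "s \<in> space S"
  shows "AE \<omega> in trajectory_law S A T \<pi> s. \<forall>k. \<bar>reward_at \<omega> k\<bar> \<le> Rmax"
  unfolding AE_all_countable
proof
  fix k
  let ?P = "\<lambda>k \<omega>. step_law S A T \<pi> (state_at s \<omega> k)" and ?M = "\<lambda>_::nat. step_space S A"
  interpret IT: Ionescu_Tulcea ?P ?M by (rule Ionescu_Tulcea_trajectory[OF T \<pi> s])
  \<comment> \<open>The reward with index \<open>k\<close> sits in the entry with index
    \<open>k\<close>, so \<open>Suc k\<close> entries are needed.\<close>
  let ?J = "{0..<Suc k}"
  have pred: "Measurable.pred (PiM ?J ?M) (\<lambda>\<omega>. \<bar>reward_at \<omega> k\<bar> \<le> Rmax)"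
    unfolding reward_at_def step_space_def by measurable
  have step: "AE \<omega> in IT.C 0 k (\<lambda>_. undefined). AE \<omega>' in IT.eP k \<omega>. \<bar>reward_at \<omega>' k\<bar> \<le> Rmax"
  proof (rule AE_I2)
    fix \<omega> assume "\<omega> \<in> space (IT.C 0 k (\<lambda>_. undefined))"
    then have \<omega>: "\<omega> \<in> space (PiM {0..<k} ?M)" by (simp add: IT.space_C)
    have st: "state_at s \<omega> k \<in> space S"
      using measurable_space[OF state_at_measurable[OF T \<pi>, of k], of "(s, \<omega>)"] s \<omega>
      by (simp add: space_pair_measure)
    have "fun_upd \<omega> k \<in> measurable (?P k \<omega>) (PiM ?J ?M)"
      using \<omega> by (intro measurable_fun_upd[where J="{0..<k}"]) (auto simp: IT.sets_P)
    then show "AE \<omega>' in IT.eP k \<omega>. \<bar>reward_at \<omega>' k\<bar> \<le> Rmax"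
      unfolding IT.eP_def using pred AE_step_reward_le[OF st]
      by (subst AE_distr_iff) (auto simp: pred_def reward_at_def)
  qed
  have "AE \<omega> in IT.C 0 (Suc k) (\<lambda>_. undefined). \<bar>reward_at \<omega> k\<bar> \<le> Rmax"
  proof -
    have K: "IT.eP (0 + k) \<in> measurable (IT.C 0 k (\<lambda>_. undefined)) (subprob_algebra (PiM ?J ?M))"
      using IT.measurable_eP[of k] by (subst measurable_cong_sets[OF IT.sets_C refl]) (simp_all add: space_PiM)
    show ?thesis
      unfolding IT.C.simps(2) AE_bind[OF K pred] using step by (simp only: add_0)
  qed
  note AE_C = this
  let ?N = "{\<omega> \<in> space (PiM ?J ?M). \<not> \<bar>reward_at \<omega> k\<bar> \<le> Rmax}"
  have N: "?N \<in> sets (PiM ?J ?M)" using pred by measurable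
  have sC: "sets (IT.C 0 (Suc k) (\<lambda>_. undefined)) = sets (PiM ?J ?M)"
    using IT.sets_C[of "\<lambda>_. undefined" 0 "Suc k"] by (simp add: space_PiM del: IT.C.simps)
  have 0: "emeasure (IT.C 0 (Suc k) (\<lambda>_. undefined)) ?N = 0"
    by (rule AE_iff_measurable[THEN iffD1, OF _ _ AE_C])
       (use N sC sets_eq_imp_space_eq[OF sC] in \<open>simp_all del: IT.C.simps\<close>)
  have emb: "prod_emb ?J ?M ?J ?N = ?N"
    by (rule prod_emb_id) (auto simp: space_PiM)
  have "emeasure (trajectory_law S A T \<pi> s) (prod_emb UNIV ?M ?J ?N) = 0"
    unfolding trajectory_law_def using IT.lim[OF _ N] IT.emeasure_CI[OF subset_refl N] N 0
    by (simp add: emb del: IT.C.simps)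
  then show "AE \<omega> in trajectory_law S A T \<pi> s. \<bar>reward_at \<omega> k\<bar> \<le> Rmax"
  proof (intro AE_I)
    show "{\<omega> \<in> space (trajectory_law S A T \<pi> s). \<not> \<bar>reward_at \<omega> k\<bar> \<le> Rmax} \<subseteq> prod_emb UNIV ?M ?J ?N"
      by (auto simp: trajectory_law_def prod_emb_def space_PiM reward_at_def)
    show "prod_emb UNIV ?M ?J ?N \<in> sets (trajectory_law S A T \<pi> s)"
      unfolding trajectory_law_def using N by (simp add: measurable_prod_emb)
  qed
qed

lemma AE_rollout_truncated_return_le:
  assumes s: "s \<in> space S" and \<gamma>: "0 < \<gamma>" "\<gamma> < 1"
  shows "AE \<omega> in rollout_law S A T \<pi> l s. \<bar>truncated_return \<gamma> l \<omega>\<bar> \<le> Rmax * ((1 - \<gamma> ^ l) / (1 - \<gamma>))"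
proof -
  have "AE \<omega> in trajectory_law S A T \<pi> s. \<bar>truncated_return \<gamma> l \<omega>\<bar> \<le> Rmax * ((1 - \<gamma> ^ l) / (1 - \<gamma>))"
    using AE_trajectory_reward_le[OF s] by eventually_elim (intro abs_truncated_return_le \<gamma>, auto)
  moreover have [measurable]: "truncated_return \<gamma> l \<in> borel_measurable (PiM {..<l} (\<lambda>_. step_space S A))"
    by (rule truncated_return_measurable) simp
  ultimately show ?thesis
    unfolding rollout_law_def
    by (subst AE_distr_iff[OF restrict_trajectory_measurable[OF s]]) (simp_all add: truncated_return_restrict)
qed

text \<open>A rollout is the restriction of a trajectory, so both expectations can be taken over
  trajectories; the difference of the returns is the tail of the discounted series, dominated by a
  geometric one.\<close>

lemma truncation_bias_le:
  assumes s: "s \<in> space S" and \<gamma>: "0 < \<gamma>" "\<gamma> < 1"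
  shows "\<bar>policy_value S A T \<pi> \<gamma> s - (\<integral>\<omega>. truncated_return \<gamma> l \<omega> \<partial>rollout_law S A T \<pi> l s)\<bar>
    \<le> Rmax * (\<gamma> ^ l / (1 - \<gamma>))"
proof -
  interpret prob_space "trajectory_law S A T \<pi> s" by (rule trajectory_law_prob_space[OF s])
  let ?R = "\<lambda>\<omega>. \<Sum>k. \<gamma> ^ k * reward_at \<omega> k"
  have geo: "(\<lambda>k. \<gamma> ^ k * Rmax) sums (Rmax / (1 - \<gamma>))"
    using geometric_sums[of \<gamma>] \<gamma> sums_mult2[of "\<lambda>k. \<gamma> ^ k" "1 / (1 - \<gamma>)" Rmax] by simp
  have pt: "\<bar>?R \<omega>\<bar> \<le> Rmax / (1 - \<gamma>) \<and> \<bar>?R \<omega> - truncated_return \<gamma> l \<omega>\<bar> \<le> Rmax * (\<gamma> ^ l / (1 - \<gamma>))"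
    if R: "\<forall>k. \<bar>reward_at \<omega> k\<bar> \<le> Rmax" for \<omega>
  proof -
    have le: "norm (\<gamma> ^ k * reward_at \<omega> k) \<le> \<gamma> ^ k * Rmax" for k
      using R \<gamma> by (auto simp: abs_mult intro!: mult_left_mono)
    have sm: "summable (\<lambda>k. \<gamma> ^ k * reward_at \<omega> k)"
      by (rule summable_comparison_test'[OF sums_summable[OF geo] le])
    have "\<bar>?R \<omega>\<bar> \<le> (\<Sum>k. \<gamma> ^ k * Rmax)"
      using norm_suminf_le[OF le sums_summable[OF geo]] by simp
    moreover have "?R \<omega> - truncated_return \<gamma> l \<omega> = (\<Sum>k. \<gamma> ^ (k + l) * reward_at \<omega> (k + l))"
      using suminf_minus_initial_segment[OF sm, of l] by (simp add: truncated_return_def)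
    moreover have "\<bar>\<Sum>k. \<gamma> ^ (k + l) * reward_at \<omega> (k + l)\<bar> \<le> (\<Sum>k. \<gamma> ^ (k + l) * Rmax)"
      using norm_suminf_le[of "\<lambda>k. \<gamma> ^ (k + l) * reward_at \<omega> (k + l)", OF le
          summable_ignore_initial_segment[OF sums_summable[OF geo]]] by simp
    moreover have "(\<Sum>k. \<gamma> ^ (k + l) * Rmax) = Rmax * (\<gamma> ^ l / (1 - \<gamma>))"
      using sums_unique[OF sums_mult[OF geo, of "\<gamma> ^ l"]] by (simp add: power_add mult_ac)
    ultimately show ?thesis using sums_unique[OF geo] by simp
  qed
  have meas: "?R \<in> borel_measurable (trajectory_law S A T \<pi> s)"
      "truncated_return \<gamma> l \<in> borel_measurable (trajectory_law S A T \<pi> s)"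
    using discounted_return_measurable[of \<gamma>] truncated_return_measurable[of l UNIV \<gamma>]
    by (simp_all add: measurable_cong_sets[OF trajectory_law_prob_space(2)[OF s] refl])
  have iR: "integrable (trajectory_law S A T \<pi> s) ?R"
    by (rule integrable_const_bound[of _ "Rmax / (1 - \<gamma>)"])
       (use AE_trajectory_reward_le[OF s] meas pt in \<open>auto elim!: eventually_mono\<close>)
  have iT: "integrable (trajectory_law S A T \<pi> s) (truncated_return \<gamma> l)"
    by (rule integrable_const_bound[of _ "Rmax * ((1 - \<gamma> ^ l) / (1 - \<gamma>))"])
       (use AE_trajectory_reward_le[OF s] meas abs_truncated_return_le[OF \<gamma>] in \<open>auto elim!: eventually_mono\<close>)
  have "(\<integral>\<omega>. truncated_return \<gamma> l \<omega> \<partial>rollout_law S A T \<pi> l s) = (\<integral>\<omega>. truncated_return \<gamma> l \<omega> \<partial>trajectory_law S A T \<pi> s)"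
    unfolding rollout_law_def
    by (subst integral_distr[OF restrict_trajectory_measurable[OF s] truncated_return_measurable])
       (simp_all add: truncated_return_restrict)
  then have "policy_value S A T \<pi> \<gamma> s - (\<integral>\<omega>. truncated_return \<gamma> l \<omega> \<partial>rollout_law S A T \<pi> l s)
      = (\<integral>\<omega>. ?R \<omega> - truncated_return \<gamma> l \<omega> \<partial>trajectory_law S A T \<pi> s)"
    unfolding policy_value_def using iR iT by simp
  also have "\<bar>\<dots>\<bar> \<le> (\<integral>\<omega>. \<bar>?R \<omega> - truncated_return \<gamma> l \<omega>\<bar> \<partial>trajectory_law S A T \<pi> s)"
    by (rule integral_abs_bound)
  also have "\<dots> \<le> (\<integral>\<omega>. Rmax * (\<gamma> ^ l / (1 - \<gamma>)) \<partial>trajectory_law S A T \<pi> s)"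
    using iR iT AE_trajectory_reward_le[OF s] pt by (intro integral_mono_AE) (auto elim!: eventually_mono)
  finally show ?thesis by (simp add: prob_space)
qed

end

section \<open>The law of a single data point\<close>

context
  fixes d :: "'s measure"
  assumes d: "d \<in> space (prob_algebra S)"
begin

lemma data_point_kernel_measurable:
  "(\<lambda>s. distr (PiM {..<n} (\<lambda>_. rollout_law S A T \<pi> l s)) (data_point_space S A l n) (\<lambda>\<rho>. (s, \<rho>)))
     \<in> S \<rightarrow>\<^sub>M prob_algebra (data_point_space S A l n)"
  unfolding data_point_space_def
  by (rule measurable_distr_prob_space2[OF rollouts_law_measurable[OF T \<pi>]]) simp

text \<open>Disintegration along the state: the inner factor is the conditional probability of the
  section of \<open>X\<close>, under which the rollouts are i.i.d.\<close>

lemma emeasure_data_point_law: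
  assumes X: "X \<in> sets (data_point_space S A l n)"
  shows "emeasure (data_point_law S A T \<pi> d l n) X =
    (\<integral>\<^sup>+s. emeasure (PiM {..<n} (\<lambda>_. rollout_law S A T \<pi> l s))
      {\<rho> \<in> space (PiM {..<n} (\<lambda>_. rollout_law S A T \<pi> l s)). (s, \<rho>) \<in> X} \<partial>d)"
proof -
  have sd: "sets d = sets S" using d by (simp add: space_prob_algebra)
  have "emeasure (data_point_law S A T \<pi> d l n) X = (\<integral>\<^sup>+s. emeasure (distr (PiM {..<n} (\<lambda>_. rollout_law S A T \<pi> l s))
      (data_point_space S A l n) (\<lambda>\<rho>. (s, \<rho>))) X \<partial>d)"
    unfolding data_point_law_def by (rule emeasure_bind_prob_algebra[OF d data_point_kernel_measurable X])
  also have "\<dots> = (\<integral>\<^sup>+s. emeasure (PiM {..<n} (\<lambda>_. rollout_law S A T \<pi> l s))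
      {\<rho> \<in> space (PiM {..<n} (\<lambda>_. rollout_law S A T \<pi> l s)). (s, \<rho>) \<in> X} \<partial>d)"
  proof (rule nn_integral_cong)
    fix s assume "s \<in> space d"
    then have s: "s \<in> space S" using sets_eq_imp_space_eq[OF sd] by simp
    have sP: "sets (PiM {..<n} (\<lambda>_. rollout_law S A T \<pi> l s)) = sets (PiM {..<n} (\<lambda>_. PiM {..<l} (\<lambda>_. step_space S A)))"
      using rollout_law_prob_space(2)[OF s] by (intro sets_PiM_cong) auto
    have "(\<lambda>\<rho>. (s, \<rho>)) \<in> measurable (PiM {..<n} (\<lambda>_. rollout_law S A T \<pi> l s)) (data_point_space S A l n)"
      unfolding data_point_space_def using s by (subst measurable_cong_sets[OF sP refl]) simp
    then show "emeasure (distr (PiM {..<n} (\<lambda>_. rollout_law S A T \<pi> l s)) (data_point_space S A l n) (\<lambda>\<rho>. (s, \<rho>))) X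
      = emeasure (PiM {..<n} (\<lambda>_. rollout_law S A T \<pi> l s))
      {\<rho> \<in> space (PiM {..<n} (\<lambda>_. rollout_law S A T \<pi> l s)). (s, \<rho>) \<in> X}"
      using X by (subst emeasure_distr) (auto intro!: arg_cong2[where f=emeasure])
  qed
  finally show ?thesis .
qed

lemma data_point_law_prob_space:
  shows "prob_space (data_point_law S A T \<pi> d l n)"
    and "sets (data_point_law S A T \<pi> d l n) = sets (data_point_space S A l n)"
  using data_point_law_in_prob_algebra[OF T \<pi> d, of l n] by (auto simp: space_prob_algebra)

text \<open>Every section of a set that restricts only the state is full or empty. This lets the
  population loss be read as an expectation over a data point.\<close>

lemma distr_data_point_law_fst: "distr (data_point_law S A T \<pi> d l n) S fst = d"
proof (rule measure_eqI)
  have sd: "sets d = sets S" using d by (simp add: space_prob_algebra)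
  show "sets (distr (data_point_law S A T \<pi> d l n) S fst) = sets d" using sd by simp
  have fst: "fst \<in> measurable (data_point_space S A l n) S"
    unfolding data_point_space_def by simp
  then have fst': "fst \<in> measurable (data_point_law S A T \<pi> d l n) S"
    by (simp add: measurable_cong_sets[OF data_point_law_prob_space(2) refl])
  fix X assume "X \<in> sets (distr (data_point_law S A T \<pi> d l n) S fst)"
  then have X: "X \<in> sets S" by simp
  have sp: "space (data_point_law S A T \<pi> d l n) = space (data_point_space S A l n)"
    by (rule sets_eq_imp_space_eq[OF data_point_law_prob_space(2)])
  have "emeasure (distr (data_point_law S A T \<pi> d l n) S fst) X =
      emeasure (data_point_law S A T \<pi> d l n) (fst -` X \<inter> space (data_point_space S A l n))"
    by (subst emeasure_distr[OF fst' X]) (simp add: sp)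
  also have "\<dots> = (\<integral>\<^sup>+s. indicator X s \<partial>d)"
  proof (subst emeasure_data_point_law[OF measurable_sets[OF fst X]], rule nn_integral_cong)
    fix s assume "s \<in> space d"
    then have s: "s \<in> space S" using sets_eq_imp_space_eq[OF sd] by simp
    interpret prob_space "PiM {..<n} (\<lambda>_. rollout_law S A T \<pi> l s)"
      using rollout_law_prob_space(1)[OF s] by (intro prob_space_PiM) auto
    have sP: "space (PiM {..<n} (\<lambda>_. rollout_law S A T \<pi> l s)) = space (PiM {..<n} (\<lambda>_. PiM {..<l} (\<lambda>_. step_space S A)))"
      using rollout_law_prob_space(2)[OF s] by (intro sets_eq_imp_space_eq sets_PiM_cong) auto
    have "{\<rho> \<in> space (PiM {..<n} (\<lambda>_. rollout_law S A T \<pi> l s)). (s, \<rho>) \<in> fst -` X \<inter> space (data_point_space S A l n)}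
      = (if s \<in> X then space (PiM {..<n} (\<lambda>_. rollout_law S A T \<pi> l s)) else {})"
      using s sP by (auto simp: data_point_space_def space_pair_measure)
    then show "emeasure (PiM {..<n} (\<lambda>_. rollout_law S A T \<pi> l s))
        {\<rho> \<in> space (PiM {..<n} (\<lambda>_. rollout_law S A T \<pi> l s)). (s, \<rho>) \<in> fst -` X \<inter> space (data_point_space S A l n)}
      = indicator X s"
      by (simp add: emeasure_space_1)
  qed
  also have "\<dots> = emeasure d X" using X sd by (intro nn_integral_indicator) simp
  finally show "emeasure (distr (data_point_law S A T \<pi> d l n) S fst) X = emeasure d X" .
qed

text \<open>Given the state, the returns are i.i.d. and bounded, so the empirical Bernstein
  inequality applies to each section with a constant independent of the state; integrating over the
  state keeps it.\<close>

lemma data_point_deviation: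
  fixes x Rmax \<gamma> :: real and l n :: nat
  assumes Rmax: "\<And>s a. s \<in> space S \<Longrightarrow> a \<in> space A \<Longrightarrow> AE x in T (s, a). \<bar>fst x\<bar> \<le> Rmax"
    and \<gamma>: "0 < \<gamma>" "\<gamma> < 1" and n: "1 \<le> n" and x: "6 \<le> exp x"
  defines "g \<equiv> \<lambda>(p :: 's \<times> (nat \<Rightarrow> nat \<Rightarrow> 'a \<times> real \<times> 's)) j. truncated_return \<gamma> l (snd p j)"
  defines "avg \<equiv> \<lambda>p. (\<Sum>j<n. g p j) / n"
  defines "X \<equiv> {p \<in> space (data_point_space S A l n).
    sqrt ((\<Sum>j<n. (g p j - avg p)\<^sup>2) / n) * sqrt (2 * (x / n)) + 3 * (Rmax * ((1 - \<gamma> ^ l) / (1 - \<gamma>))) * (x / n)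
      < \<bar>avg p - (\<integral>\<omega>. truncated_return \<gamma> l \<omega> \<partial>rollout_law S A T \<pi> l (fst p))\<bar>}"
  shows "X \<in> sets (data_point_space S A l n)" and "measure (data_point_law S A T \<pi> d l n) X \<le> 3 * exp (- x)"
proof -
  have [measurable]: "(\<lambda>p. g p j) \<in> borel_measurable (data_point_space S A l n)" if "j < n" for j
    unfolding g_def by (rule rollout_return_measurable[OF that])
  have [measurable]: "avg \<in> borel_measurable (data_point_space S A l n)"
    unfolding avg_def by (intro borel_measurable_divide borel_measurable_sum) auto
  have [measurable]: "(\<lambda>p. \<integral>\<omega>. truncated_return \<gamma> l \<omega> \<partial>rollout_law S A T \<pi> l (fst p)) \<in> borel_measurable (data_point_space S A l n)"
    unfolding data_point_space_def
    by (rule measurable_compose[OF measurable_fst expected_truncated_return_measurable])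
  have [measurable]: "(\<lambda>p. \<Sum>j<n. (g p j - avg p)\<^sup>2) \<in> borel_measurable (data_point_space S A l n)"
    by (intro borel_measurable_sum) auto
  show X: "X \<in> sets (data_point_space S A l n)"
    unfolding X_def by measurable
  interpret prob_space d using d by (simp add: space_prob_algebra)
  interpret D: prob_space "data_point_law S A T \<pi> d l n" by (rule data_point_law_prob_space)
  have "emeasure (data_point_law S A T \<pi> d l n) X \<le> (\<integral>\<^sup>+s. ennreal (3 * exp (- x)) \<partial>d)"
    unfolding emeasure_data_point_law[OF X]
  proof (rule nn_integral_mono)
    fix s assume "s \<in> space d"
    then have s: "s \<in> space S" using d by (auto simp: space_prob_algebra dest: sets_eq_imp_space_eq)
    note R = rollout_law_prob_space[OF s, of l]
    interpret P: prob_space "PiM {..<n} (\<lambda>_. rollout_law S A T \<pi> l s)"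
      using R(1) by (intro prob_space_PiM) auto
    have sP: "space (PiM {..<n} (\<lambda>_. rollout_law S A T \<pi> l s)) = space (PiM {..<n} (\<lambda>_. PiM {..<l} (\<lambda>_. step_space S A)))"
      using R(2) by (intro sets_eq_imp_space_eq sets_PiM_cong) auto
    have f: "truncated_return \<gamma> l \<in> borel_measurable (rollout_law S A T \<pi> l s)"
      using truncated_return_measurable[OF order_refl] by (simp add: measurable_cong_sets[OF R(2) refl])
    have "{\<rho> \<in> space (PiM {..<n} (\<lambda>_. rollout_law S A T \<pi> l s)). (s, \<rho>) \<in> X} =
      {\<rho> \<in> space (PiM {..<n} (\<lambda>_. rollout_law S A T \<pi> l s)).
        sqrt ((\<Sum>j<n. (truncated_return \<gamma> l (\<rho> j) - (\<Sum>j<n. truncated_return \<gamma> l (\<rho> j)) / n)\<^sup>2) / n) * sqrt (2 * (x / n))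
          + 3 * (Rmax * ((1 - \<gamma> ^ l) / (1 - \<gamma>))) * (x / n)
        < \<bar>(\<Sum>j<n. truncated_return \<gamma> l (\<rho> j)) / n - (\<integral>\<omega>. truncated_return \<gamma> l \<omega> \<partial>rollout_law S A T \<pi> l s)\<bar>}"
      using s sP by (auto simp: X_def g_def avg_def data_point_space_def space_pair_measure)
    then have "measure (PiM {..<n} (\<lambda>_. rollout_law S A T \<pi> l s))
        {\<rho> \<in> space (PiM {..<n} (\<lambda>_. rollout_law S A T \<pi> l s)). (s, \<rho>) \<in> X} \<le> 3 * exp (- x)"
      using empirical_bernstein[OF R(1) f AE_rollout_truncated_return_le[OF Rmax s \<gamma>] n x] by simp
    then show "emeasure (PiM {..<n} (\<lambda>_. rollout_law S A T \<pi> l s))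
        {\<rho> \<in> space (PiM {..<n} (\<lambda>_. rollout_law S A T \<pi> l s)). (s, \<rho>) \<in> X} \<le> ennreal (3 * exp (- x))"
      by (simp add: P.emeasure_eq_measure)
  qed
  also have "\<dots> = ennreal (3 * exp (- x))" by (simp add: emeasure_space_1)
  finally show "measure (data_point_law S A T \<pi> d l n) X \<le> 3 * exp (- x)"
    by (simp add: D.emeasure_eq_measure)
qed

end

end

section \<open>Union bound for the clipped loss\<close>

lemma clipped_diff_le:
  fixes c a b v :: real
  shows "\<bar>min c \<bar>v - a\<bar> - min c \<bar>v - b\<bar>\<bar> \<le> \<bar>b - a\<bar>"
  by linarith

theorem theorem8:
  fixes S :: "'s measure" and A :: "'a measure"
    and T :: "'s \<times> 'a \<Rightarrow> (real \<times> 's) measure" and \<pi> :: "'s \<Rightarrow> 'a measure"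
    and d :: "'s measure" and V :: "('s \<Rightarrow> real) set"
    and Rmax \<gamma> c \<delta> :: real and m n l K :: nat
  assumes "T \<in> S \<Otimes>\<^sub>M A \<rightarrow>\<^sub>M prob_algebra (borel \<Otimes>\<^sub>M S)"
    and "\<And>s a. s \<in> space S \<Longrightarrow> a \<in> space A \<Longrightarrow> AE x in T (s, a). \<bar>fst x\<bar> \<le> Rmax"
    and "\<pi> \<in> S \<rightarrow>\<^sub>M prob_algebra A"
    and "d \<in> space (prob_algebra S)"
    and "0 < c" "0 < \<delta>" "\<delta> < 1" "0 < \<gamma>" "\<gamma> < 1"
    and "1 \<le> m" "1 \<le> n" "1 \<le> l" "1 \<le> K"
    and "V \<subseteq> borel_measurable S" "card V = K"
  shows "measure (sample_law S A T \<pi> d l n m)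
     {D \<in> space (sample_law S A T \<pi> d l n m). \<forall>vh\<in>V.
        \<bar>clipped_loss d c vh (policy_value S A T \<pi> \<gamma>)
            - empirical_clipped_loss m (sampled_state D) c vh (value_estimate \<gamma> l n D)\<bar>
          \<le> sqrt (ln (4 * real K / \<delta>) * c\<^sup>2 / (2 * real m))
            + (3 * Rmax * ((1 - \<gamma> ^ l) / (1 - \<gamma>)) * (ln (6 * real m / \<delta>) / real n)
               + (\<Sum>i<m. return_std \<gamma> l n D i) / real m * sqrt (2 * ln (6 * real m / \<delta>) / real n)
               + Rmax * (\<gamma> ^ l / (1 - \<gamma>)))}
     \<ge> 1 - \<delta>"
    (is "measure ?P ?good \<ge> _")
proof -
  note T = assms(1) and Rmax = assms(2) and \<pi> = assms(3) and d = assms(4)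
  note c = assms(5) and \<delta> = assms(6,7) and \<gamma> = assms(8,9) and m = assms(10) and n = assms(11)
  note V = assms(14,15)
  \<comment> \<open>\<open>card\<close> is 0 on infinite sets, so \<open>1 \<le> K\<close> makes
    \<open>V\<close> finite.\<close>
  have finV: "finite V" using V(2) assms(13) by (intro card_ge_0_finite) simp
  have m0: "0 < real m" and n0: "0 < real n" and K0: "0 < real K" using m n assms(13) by auto
  define Q where "Q = data_point_law S A T \<pi> d l n"
  have Q: "prob_space Q" "sets Q = sets (data_point_space S A l n)"
    unfolding Q_def by (rule data_point_law_prob_space[OF T \<pi> d])+
  have P: "?P = PiM {..<m} (\<lambda>_. Q)" by (simp add: sample_law_def Q_def)
  interpret Q: prob_space Q by (rule Q(1))
  interpret P: prob_space ?P by (rule prob_space_sample_law[OF T \<pi> d])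
  have spd: "space d = space S" and setsd: "sets d = sets S"
    using d by (auto simp: space_prob_algebra dest: sets_eq_imp_space_eq)

  \<comment> \<open>Chosen so that the Hoeffding failure has probability at most
    \<open>2 * (\<delta> / (4 * K))\<close> per function and the Bernstein failure at most
    \<open>3 * (\<delta> / (6 * m))\<close> per data point; each family sums to
    \<open>\<delta> / 2\<close>.\<close>
  define \<epsilon> x where "\<epsilon> = sqrt (ln (4 * real K / \<delta>) * c\<^sup>2 / (2 * real m))" and "x = ln (6 * real m / \<delta>)"
  have lnK: "0 < ln (4 * real K / \<delta>)"
    using assms(13) \<delta> by (intro ln_gt_zero) (simp add: less_divide_eq)
  have \<epsilon>: "0 < \<epsilon>" using lnK c m0 by (simp add: \<epsilon>_def)
  have ex: "exp x = 6 * real m / \<delta>" using m0 \<delta> by (simp add: x_def)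
  have x6: "6 \<le> exp x" unfolding ex using m \<delta> by (simp add: le_divide_eq)

  define vs where "vs = policy_value S A T \<pi> \<gamma>"
  have vs[measurable]: "vs \<in> borel_measurable S" unfolding vs_def by (rule policy_value_measurable[OF T \<pi>])
  have V_meas[measurable]: "vh \<in> borel_measurable S" if "vh \<in> V" for vh using V(1) that by auto
  have fstQ[measurable]: "fst \<in> measurable Q S"
    by (subst measurable_cong_sets[OF Q(2) refl]) (simp add: data_point_space_def)
  have retQ[measurable]: "(\<lambda>p. truncated_return \<gamma> l (snd p j)) \<in> borel_measurable Q" if "j < n" for j
    using rollout_return_measurable[OF that] by (simp add: measurable_cong_sets[OF Q(2) refl])

  have proj: "(\<lambda>D. D i) \<in> measurable ?P Q" if "i < m" for i unfolding P using that by simp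

  \<comment> \<open>\<open>H vh\<close> is the Hoeffding failure for the loss against the exact
    values, phrased on whole data points so that it lives on the same space as \<open>U i\<close>,
    the Bernstein failure at the data point with index \<open>i\<close>.\<close>
  define H where "H = (\<lambda>vh. {D \<in> space ?P. \<epsilon> < \<bar>(\<integral>p. min c \<bar>vh (fst p) - vs (fst p)\<bar> \<partial>Q)
      - (\<Sum>i<m. min c \<bar>vh (fst (D i)) - vs (fst (D i))\<bar>) / m\<bar>})"
  define X where "X = {p \<in> space (data_point_space S A l n).
    sqrt ((\<Sum>j<n. (truncated_return \<gamma> l (snd p j) - (\<Sum>j<n. truncated_return \<gamma> l (snd p j)) / n)\<^sup>2) / n) * sqrt (2 * (x / n))
      + 3 * (Rmax * ((1 - \<gamma> ^ l) / (1 - \<gamma>))) * (x / n)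
      < \<bar>(\<Sum>j<n. truncated_return \<gamma> l (snd p j)) / n - (\<integral>\<omega>. truncated_return \<gamma> l \<omega> \<partial>rollout_law S A T \<pi> l (fst p))\<bar>}"
  define U where "U = (\<lambda>i. {D \<in> space ?P. D i \<in> X})"
  have X: "X \<in> sets Q" "measure Q X \<le> 3 * exp (- x)"
    unfolding Q(2) unfolding X_def Q_def
    by (rule data_point_deviation(1)[OF T \<pi> d Rmax \<gamma> n x6], assumption, assumption)
       (rule data_point_deviation(2)[OF T \<pi> d Rmax \<gamma> n x6], assumption, assumption)

  have H: "measure ?P (H vh) \<le> 2 * exp (- ln (4 * real K / \<delta>))" "H vh \<in> sets ?P" if vh: "vh \<in> V" for vh
  proof -
    have [measurable]: "vh \<in> borel_measurable S" using vh by (rule V_meas)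
    have g: "(\<lambda>p. min c \<bar>vh (fst p) - vs (fst p)\<bar>) \<in> borel_measurable Q" by measurable
    have "- 2 * m * \<epsilon>\<^sup>2 / c\<^sup>2 = - ln (4 * real K / \<delta>)"
      using lnK c m0 by (simp add: \<epsilon>_def)
    with hoeffding_PiM[OF Q(1) g _ c m \<epsilon>] c
    show "measure ?P (H vh) \<le> 2 * exp (- ln (4 * real K / \<delta>))"
      unfolding H_def P by (simp add: AE_I2)
    show "H vh \<in> sets ?P" unfolding H_def P using g by measurable
  qed
  have U: "measure ?P (U i) \<le> 3 * exp (- x)" "U i \<in> sets ?P" if i: "i < m" for i
  proof -
    note proj = proj[OF i]
    have Ui: "U i = (\<lambda>D. D i) -` X \<inter> space ?P" by (auto simp: U_def)
    show "U i \<in> sets ?P" unfolding Ui using proj X(1) by (rule measurable_sets)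
    have "measure ?P (U i) = measure (distr ?P Q (\<lambda>D. D i)) X"
      unfolding Ui using proj X(1) by (simp add: measure_distr)
    also have "distr ?P Q (\<lambda>D. D i) = Q"
      unfolding P using i Q(1) by (intro distr_PiM_component) auto
    finally show "measure ?P (U i) \<le> 3 * exp (- x)" using X(2) by simp
  qed
  have loss: "clipped_loss d c vh vs = (\<integral>p. min c \<bar>vh (fst p) - vs (fst p)\<bar> \<partial>Q)" if vh: "vh \<in> V" for vh
  proof -
    have [measurable]: "vh \<in> borel_measurable S" using vh by (rule V_meas)
    have "clipped_loss d c vh vs = (\<integral>s. min c \<bar>vh s - vs s\<bar> \<partial>distr Q S fst)"
      unfolding clipped_loss_def Q_def distr_data_point_law_fst[OF T \<pi> d] ..
    also have "\<dots> = (\<integral>p. min c \<bar>vh (fst p) - vs (fst p)\<bar> \<partial>Q)" by (rule integral_distr) measurable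
    finally show ?thesis .
  qed

  \<comment> \<open>Measurability is what allows passing to the probability of the complement at the
    end.\<close>
  have good_sets: "?good \<in> sets ?P"
  proof -
    have ret: "(\<lambda>D. sampled_return \<gamma> l D i j) \<in> borel_measurable ?P" if "i < m" "j < n" for i j
      unfolding sampled_return_def
      by (rule measurable_compose[OF proj[OF that(1)], where g = "\<lambda>p. truncated_return \<gamma> l (snd p j)"])
         (rule retQ[OF that(2)])
    have est: "(\<lambda>D. value_estimate \<gamma> l n D i) \<in> borel_measurable ?P" if "i < m" for i
      unfolding value_estimate_def using ret that by (intro borel_measurable_divide borel_measurable_sum) auto
    have std: "(\<lambda>D. return_std \<gamma> l n D i) \<in> borel_measurable ?P" if "i < m" for i
      unfolding return_std_def using ret est that
      by (intro measurable_compose[OF _ borel_measurable_sqrt] borel_measurable_divide borel_measurable_sum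
          borel_measurable_power borel_measurable_diff) auto
    have state: "(\<lambda>D. sampled_state D i) \<in> measurable ?P S" if "i < m" for i
      unfolding sampled_state_def by (rule measurable_compose[OF proj[OF that] fstQ])
    have "(\<lambda>D. vh (sampled_state D i)) \<in> borel_measurable ?P" if "i < m" "vh \<in> V" for i vh
      by (rule measurable_compose[OF state[OF that(1)] V_meas[OF that(2)]])
    then have emp: "(\<lambda>D. empirical_clipped_loss m (sampled_state D) c vh (value_estimate \<gamma> l n D)) \<in> borel_measurable ?P"
      if "vh \<in> V" for vh
      unfolding empirical_clipped_loss_def using est that
      by (intro borel_measurable_divide borel_measurable_sum borel_measurable_min borel_measurable_abs borel_measurable_diff) auto
    have sums: "(\<lambda>D. \<Sum>i<m. return_std \<gamma> l n D i) \<in> borel_measurable ?P"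
      using std by (intro borel_measurable_sum) auto
    show ?thesis
      by (intro sets.sets_Collect_finite_All' finV borel_measurable_le borel_measurable_abs borel_measurable_diff
          borel_measurable_add borel_measurable_times borel_measurable_divide borel_measurable_const emp sums)
        (use V(2) assms(13) in auto)
  qed

  have cover: "space ?P - ?good \<subseteq> (\<Union>vh\<in>V. H vh) \<union> (\<Union>i<m. U i)"
  proof
    fix D assume D: "D \<in> space ?P - ?good"
    show "D \<in> (\<Union>vh\<in>V. H vh) \<union> (\<Union>i<m. U i)"
    proof (rule ccontr)
      assume not: "D \<notin> (\<Union>vh\<in>V. H vh) \<union> (\<Union>i<m. U i)"
      \<comment> \<open>The total error allowed for one estimate, Monte Carlo part plus truncation
        bias; its average over the sample is the additive term of the claim.\<close>
      define \<eta> where "\<eta> = (\<lambda>i. return_std \<gamma> l n D i * sqrt (2 * (x / n))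
        + 3 * (Rmax * ((1 - \<gamma> ^ l) / (1 - \<gamma>))) * (x / n) + Rmax * (\<gamma> ^ l / (1 - \<gamma>)))"
      have err: "\<bar>value_estimate \<gamma> l n D i - vs (sampled_state D i)\<bar> \<le> \<eta> i" if i: "i < m" for i
      proof -
        have Di: "D i \<in> space (data_point_space S A l n)"
          using D i sets_eq_imp_space_eq[OF Q(2)] by (auto simp: P space_PiM)
        then have s: "sampled_state D i \<in> space S"
          by (auto simp: data_point_space_def space_pair_measure sampled_state_def)
        have "D i \<notin> X" using not D i by (auto simp: U_def)
        then have "\<bar>value_estimate \<gamma> l n D i - (\<integral>\<omega>. truncated_return \<gamma> l \<omega> \<partial>rollout_law S A T \<pi> l (sampled_state D i))\<bar>
          \<le> return_std \<gamma> l n D i * sqrt (2 * (x / n)) + 3 * (Rmax * ((1 - \<gamma> ^ l) / (1 - \<gamma>))) * (x / n)"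
          using Di by (simp add: X_def value_estimate_def return_std_def sampled_return_def sampled_state_def)
        moreover have "\<bar>vs (sampled_state D i) - (\<integral>\<omega>. truncated_return \<gamma> l \<omega> \<partial>rollout_law S A T \<pi> l (sampled_state D i))\<bar>
          \<le> Rmax * (\<gamma> ^ l / (1 - \<gamma>))"
          unfolding vs_def by (rule truncation_bias_le[OF T \<pi> Rmax s \<gamma>])
        ultimately show ?thesis unfolding \<eta>_def by linarith
      qed
      have avg_\<eta>: "(\<Sum>i<m. \<eta> i) / m = 3 * Rmax * ((1 - \<gamma> ^ l) / (1 - \<gamma>)) * (x / n)
          + (\<Sum>i<m. return_std \<gamma> l n D i) / m * sqrt (2 * x / n) + Rmax * (\<gamma> ^ l / (1 - \<gamma>))"
        unfolding \<eta>_def using m0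
        by (simp add: sum.distrib sum_distrib_right[symmetric] add_divide_distrib mult.assoc)
      have "\<bar>clipped_loss d c vh vs - empirical_clipped_loss m (sampled_state D) c vh (value_estimate \<gamma> l n D)\<bar>
          \<le> \<epsilon> + (\<Sum>i<m. \<eta> i) / m" if vh: "vh \<in> V" for vh
      proof -
        define e1 e2 where "e1 = (\<Sum>i<m. min c \<bar>vh (sampled_state D i) - vs (sampled_state D i)\<bar>) / m"
          and "e2 = empirical_clipped_loss m (sampled_state D) c vh (value_estimate \<gamma> l n D)"
        have "D \<notin> H vh" using not vh by auto
        then have "\<bar>clipped_loss d c vh vs - e1\<bar> \<le> \<epsilon>"
          using D by (auto simp: H_def loss[OF vh] e1_def sampled_state_def)
        moreover have "\<bar>e1 - e2\<bar> \<le> (\<Sum>i<m. \<eta> i) / m"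
        proof -
          have "\<bar>e1 - e2\<bar> = \<bar>\<Sum>i<m. min c \<bar>vh (sampled_state D i) - vs (sampled_state D i)\<bar>
              - min c \<bar>vh (sampled_state D i) - value_estimate \<gamma> l n D i\<bar>\<bar> / m"
            by (simp add: e1_def e2_def empirical_clipped_loss_def diff_divide_distrib sum_subtractf abs_divide flip: diff_divide_distrib)
          also have "\<dots> \<le> (\<Sum>i<m. \<eta> i) / m"
          proof (intro divide_right_mono order_trans[OF sum_abs] sum_mono)
            fix i assume "i \<in> {..<m}"
            then show "\<bar>min c \<bar>vh (sampled_state D i) - vs (sampled_state D i)\<bar>
              - min c \<bar>vh (sampled_state D i) - value_estimate \<gamma> l n D i\<bar>\<bar> \<le> \<eta> i"
              using err[of i] by (intro order_trans[OF clipped_diff_le]) auto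
          qed simp
          finally show ?thesis .
        qed
        ultimately show ?thesis unfolding e2_def[symmetric] by linarith
      qed
      then have "D \<in> ?good"
        using D unfolding avg_\<eta> by (simp add: vs_def \<epsilon>_def x_def add.assoc)
      with D show False by simp
    qed
  qed

  have UN: "(\<Union>vh\<in>V. H vh) \<in> sets ?P" "(\<Union>i<m. U i) \<in> sets ?P"
    using finV H(2) U(2) by (auto intro!: sets.finite_UN simp del: UN_simps)
  have "measure ?P (space ?P - ?good) \<le> measure ?P ((\<Union>vh\<in>V. H vh) \<union> (\<Union>i<m. U i))"
    using UN by (intro P.finite_measure_mono[OF cover] sets.Un)
  also have "\<dots> \<le> measure ?P (\<Union>vh\<in>V. H vh) + measure ?P (\<Union>i<m. U i)"
    using UN by (rule measure_Un_le)
  also have "\<dots> \<le> (\<Sum>vh\<in>V. measure ?P (H vh)) + (\<Sum>i<m. measure ?P (U i))"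
    using finV H(2) U(2) by (intro add_mono measure_UNION_le) simp_all
  also have "\<dots> \<le> (\<Sum>vh\<in>V. 2 * exp (- ln (4 * real K / \<delta>))) + (\<Sum>i<m. 3 * exp (- x))"
    using H(1) U(1) by (intro add_mono sum_mono) auto
  also have "\<dots> = \<delta>"
    using V(2) \<delta> K0 m0 by (simp add: exp_minus ex)
  finally show ?thesis
    using P.prob_compl[OF good_sets] by simp
qed

end
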